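(* There exist a function $\lambda:(0,|\xi|_c)\to(0,\infty)$ and, for every $\xi=(\xi_1,\xi_2)\in\mathbb{R}^2$ with $0<|\xi|^2<g[[\rho_0]]/\sigma$, real-valued functions $\varphi=\varphi(\xi,x_3)$, $\theta=\theta(\xi,x_3)$, $\psi=\psi(\xi,x_3)$ of $x_3\in(-m,\ell)$, smooth when restricted to $(-m,0)$ or $(0,\ell)$, with $\psi(\xi,0)\neq 0$, such that with $\lambda=\lambda(|\xi|)>0$ the following hold (where $'=d/dx_3$). On $(-m,0)$ and on $(0,\ell)$: $$-(\lambda\varepsilon_0\varphi')'+\left[\lambda^2\rho_0+\lambda\varepsilon_0|\xi|^2+\xi_1^2\left(\lambda\delta_0+\lambda\varepsilon_0/3+P'(\rho_0)\rho_0\right)\right]\varphi=-\xi_1\left[\left(\lambda\delta_0+\lambda\varepsilon_0/3+P'(\rho_0)\rho_0\right)\psi'+(\lambda\varepsilon_0'-g\rho_0)\psi\right]-\xi_1\xi_2\left[\lambda\delta_0+\lambda\varepsilon_0/3+P'(\rho_0)\rho_0\right]\theta,$$ $$-(\lambda\varepsilon_0\theta')'+\left[\lambda^2\rho_0+\lambda\varepsilon_0|\xi|^2+\xi_2^2\left(\lambda\delta_0+\lambda\varepsilon_0/3+P'(\rho_0)\rho_0\right)\right]\theta=-\xi_2\left[\left(\lambda\delta_0+\lambda\varepsilon_0/3+P'(\rho_0)\rho_0\right)\psi'+(\lambda\varepsilon_0'-g\rho_0)\psi\right]-\xi_1\xi_2\left[\lambda\delta_0+\lambda\varepsilon_0/3+P'(\rho_0)\rho_0\right]\varphi,$$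 $$-\left[\left(4\lambda\varepsilon_0/3+\lambda\delta_0+P'(\rho_0)\rho_0\right)\psi'\right]'+\left(\lambda^2\rho_0+\lambda\varepsilon_0|\xi|^2\right)\psi=\left[\left(\lambda\delta_0+\lambda\varepsilon_0/3+P'(\rho_0)\rho_0\right)(\xi_1\varphi+\xi_2\theta)\right]'+(g\rho_0-\lambda\varepsilon_0')(\xi_1\varphi+\xi_2\theta).$$ Jump conditions at $x_3=0$: $[[\varphi]]=[[\theta]]=[[\psi]]=0$, $[[\lambda\varepsilon_0(\varphi'-\xi_1\psi)]]=[[\lambda\varepsilon_0(\theta'-\xi_2\psi)]]=0$, and $$[[(\lambda\delta_0+\lambda\varepsilon_0/3+P'(\rho_0)\rho_0)(\psi'+\xi_1\varphi+\xi_2\theta)]]+[[\lambda\varepsilon_0(\psi'-\xi_1\varphi-\xi_2\theta)]]=\sigma|\xi|^2\psi(\xi,0).$$ Boundary conditions: $\varphi=\theta=\psi=0$ at $x_3=-m$ and at $x_3=\ell$. Moreover the solutions are equivariant in $\xi$: for every rotation $R\in SO(2)$, $$\begin{pmatrix}\varphi(R\xi,x_3)\\ \theta(R\xi,x_3)\\ \psi(R\xi,x_3)\end{pmatrix}=\begin{pmatrix}R_{11}&R_{12}&0\\R_{21}&R_{22}&0\\0&0&1\end{pmatrix}\begin{pmatrix}\varphi(\xi,x_3)\\ \theta(\xi,x_3)\\ \psi(\xi,x_3)\end{pmatrix}.$$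
   Context: Parameters and steady state. Fix $g>0$, $\sigma\ge 0$, $m,\ell>0$. Let $P_\pm\in C^\infty((0,\infty))$ be positive and strictly increasing with $1/P_\pm'\in L^\infty_{loc}((0,\infty))$; let $\varepsilon_\pm,\delta_\pm\in C^\infty((0,\infty))$ with $\varepsilon_\pm>0$, $\delta_\pm\ge0$. Put $h_\pm(z)=\int_1^z P_\pm'(r)/r\,dr$. Assume $Z=\{z>0: P_-(z)>P_+(z),\ P_-(z)\in P_+((0,\infty))\}$ is nonempty, fix $\rho_0^-\in Z$ and set $\rho_0^+=P_+^{-1}(P_-(\rho_0^-))$. Assume $h_-(\rho_0^-)+gm\in h_-((0,\infty))$ and $h_+(\rho_0^+)-g\ell\in h_+((0,\infty))$. Define $\rho_0(x_3)=h_-^{-1}(h_-(\rho_0^-)-gx_3)$ for $-m<x_3<0$ and $\rho_0(x_3)=h_+^{-1}(h_+(\rho_0^+)-gx_3)$ for $0<x_3<\ell$; then $\rho_0$ is smooth on each side, bounded above and below by positive constants, and $\frac{d}{dx_3}P(\rho_0)=-g\rho_0$ on each side. Notation. $P'(\rho_0)$, $\varepsilon_0=\varepsilon(\rho_0)$, $\delta_0=\delta(\rho_0)$ mean $P_+'(\rho_0),\varepsilon_+(\rho_0),\delta_+(\rho_0)$ for $x_3>0$ and $P_-'(\rho_0),\varepsilon_-(\rho_0),\delta_-(\rho_0)$ for $x_3<0$; $\varepsilon_0'=d\varepsilon_0/dx_3$ on each side. For a function $f$ with one-sided limits at $x_3=0$, $[[f]]=f(0^+)-f(0^-)$. In particular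 $[[\rho_0]]=\rho_0^+-\rho_0^->0$. $|\xi|_c=\sqrt{g[[\rho_0]]/\sigma}$, with the convention $g[[\rho_0]]/\sigma=|\xi|_c=+\infty$ if $\sigma=0$. *)

theory Defs
  imports "HOL-Analysis.Analysis"
begin

text \<open>Only meant for open \<open>S\<close>, where the iterated total operator \<^const>\<open>deriv\<close> agrees on \<open>S\<close> with
  the iterated derivative of the restriction of \<open>f\<close> to \<open>S\<close>.\<close>

definition smooth_on :: "real set \<Rightarrow> (real \<Rightarrow> real) \<Rightarrow> bool" where
  "smooth_on S f \<longleftrightarrow> (\<forall>n. \<forall>x\<in>S. (deriv ^^ n) f field_differentiable (at x))"

definition Linfty_loc :: "real set \<Rightarrow> (real \<Rightarrow> real) \<Rightarrow> bool" where
  "Linfty_loc S f \<longleftrightarrow> set_borel_measurable lborel S f \<and>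
     (\<forall>K. compact K \<and> K \<subseteq> S \<longrightarrow> (\<exists>C. AE x in lborel. x \<in> K \<longrightarrow> \<bar>f x\<bar> \<le> C))"

text \<open>Since \<open>1 / 0 = 0\<close> in HOL, that \<open>1 / P'\<close> is defined almost everywhere has to be said
  separately.\<close>

definition pressure_law :: "(real \<Rightarrow> real) \<Rightarrow> bool" where
  "pressure_law P \<longleftrightarrow> smooth_on {0<..} P \<and> (\<forall>z>0. 0 < P z) \<and> strict_mono_on {0<..} P \<and>
     (AE z in lborel. z \<in> {0<..} \<longrightarrow> deriv P z \<noteq> 0) \<and> Linfty_loc {0<..} (\<lambda>z. 1 / deriv P z)"

definition enthalpy :: "(real \<Rightarrow> real) \<Rightarrow> real \<Rightarrow> real" where
  "enthalpy P z = (LBINT r=ereal 1..ereal z. deriv P r / r)"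

text \<open>The densities admissible for the lower fluid at the interface (the set \<open>Z\<close>).\<close>

definition interface_densities :: "(real \<Rightarrow> real) \<Rightarrow> (real \<Rightarrow> real) \<Rightarrow> real set" where
  "interface_densities Pp Pm = {z. z > 0 \<and> Pm z > Pp z \<and> Pm z \<in> Pp ` {0<..}}"

text \<open>Subscripts: \<open>p\<close> is the upper fluid \<open>x > 0\<close>, \<open>m\<close> the lower fluid \<open>x < 0\<close>. The value at
  \<open>x = 0\<close> is a convention that is never used.\<close>

definition steady_density ::
  "real \<Rightarrow> (real \<Rightarrow> real) \<Rightarrow> (real \<Rightarrow> real) \<Rightarrow> real \<Rightarrow> real \<Rightarrow> real \<Rightarrow> real" where
  "steady_density g Pp Pm rp rm x =
     (if x < 0 then the_inv_into {0<..} (enthalpy Pm) (enthalpy Pm rm - g * x)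
      else the_inv_into {0<..} (enthalpy Pp) (enthalpy Pp rp - g * x))"

definition two_phase ::
  "(real \<Rightarrow> real) \<Rightarrow> (real \<Rightarrow> real) \<Rightarrow> (real \<Rightarrow> real) \<Rightarrow> real \<Rightarrow> real" where
  "two_phase fp fm \<rho> x = (if x < 0 then fm (\<rho> x) else fp (\<rho> x))"

text \<open>\<open>[[f]] = J\<close>, including the existence of both one-sided limits at \<open>0\<close>.\<close>

definition has_jump :: "(real \<Rightarrow> real) \<Rightarrow> real \<Rightarrow> bool" where
  "has_jump f J \<longleftrightarrow> (\<exists>a b. (f \<longlongrightarrow> a) (at_right 0) \<and> (f \<longlongrightarrow> b) (at_left 0) \<and> J = a - b)"

definition jump :: "(real \<Rightarrow> real) \<Rightarrow> real" where
  "jump f = (THE J. has_jump f J)"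

definition xi_crit_sq :: "real \<Rightarrow> real \<Rightarrow> (real \<Rightarrow> real) \<Rightarrow> ereal" where
  "xi_crit_sq g \<sigma> \<rho>0 = (if \<sigma> = 0 then \<infinity> else ereal (g * jump \<rho>0 / \<sigma>))"

definition xi_crit :: "real \<Rightarrow> real \<Rightarrow> (real \<Rightarrow> real) \<Rightarrow> ereal" where
  "xi_crit g \<sigma> \<rho>0 = (if \<sigma> = 0 then \<infinity> else ereal (sqrt (g * jump \<rho>0 / \<sigma>)))"

text \<open>\<open>dP0\<close> stands for \<open>P'(\<rho>0)\<close>, a function of the vertical coordinate \<open>x\<close>.\<close>

definition mode_odes ::
  "real \<Rightarrow> (real \<Rightarrow> real) \<Rightarrow> (real \<Rightarrow> real) \<Rightarrow> (real \<Rightarrow> real) \<Rightarrow> (real \<Rightarrow> real) \<Rightarrow> real \<Rightarrow> real^2 \<Rightarrow>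
   (real \<Rightarrow> real) \<Rightarrow> (real \<Rightarrow> real) \<Rightarrow> (real \<Rightarrow> real) \<Rightarrow> real \<Rightarrow> bool" where
  "mode_odes g \<rho>0 dP0 \<epsilon>0 \<delta>0 lam \<xi> \<phi> \<theta> \<psi> x \<longleftrightarrow>
    (let A = (\<lambda>y. lam * \<delta>0 y + lam * \<epsilon>0 y / 3 + dP0 y * \<rho>0 y) in
      - deriv (\<lambda>y. lam * \<epsilon>0 y * deriv \<phi> y) x
        + (lam\<^sup>2 * \<rho>0 x + lam * \<epsilon>0 x * (norm \<xi>)\<^sup>2 + (\<xi>$1)\<^sup>2 * A x) * \<phi> x
      = - \<xi>$1 * (A x * deriv \<psi> x + (lam * deriv \<epsilon>0 x - g * \<rho>0 x) * \<psi> x)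
        - \<xi>$1 * \<xi>$2 * A x * \<theta> x
    \<and>
      - deriv (\<lambda>y. lam * \<epsilon>0 y * deriv \<theta> y) x
        + (lam\<^sup>2 * \<rho>0 x + lam * \<epsilon>0 x * (norm \<xi>)\<^sup>2 + (\<xi>$2)\<^sup>2 * A x) * \<theta> x
      = - \<xi>$2 * (A x * deriv \<psi> x + (lam * deriv \<epsilon>0 x - g * \<rho>0 x) * \<psi> x)
        - \<xi>$1 * \<xi>$2 * A x * \<phi> x
    \<and>
      - deriv (\<lambda>y. (4 * lam * \<epsilon>0 y / 3 + lam * \<delta>0 y + dP0 y * \<rho>0 y) * deriv \<psi> y) x
        + (lam\<^sup>2 * \<rho>0 x + lam * \<epsilon>0 x * (norm \<xi>)\<^sup>2) * \<psi> x
      = deriv (\<lambda>y. A y * (\<xi>$1 * \<phi> y + \<xi>$2 * \<theta> y)) x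
        + (g * \<rho>0 x - lam * deriv \<epsilon>0 x) * (\<xi>$1 * \<phi> x + \<xi>$2 * \<theta> x))"

definition mode_jump_conditions ::
  "real \<Rightarrow> (real \<Rightarrow> real) \<Rightarrow> (real \<Rightarrow> real) \<Rightarrow> (real \<Rightarrow> real) \<Rightarrow> (real \<Rightarrow> real) \<Rightarrow> real \<Rightarrow> real^2 \<Rightarrow>
   (real \<Rightarrow> real) \<Rightarrow> (real \<Rightarrow> real) \<Rightarrow> (real \<Rightarrow> real) \<Rightarrow> bool" where
  "mode_jump_conditions \<sigma> \<rho>0 dP0 \<epsilon>0 \<delta>0 lam \<xi> \<phi> \<theta> \<psi> \<longleftrightarrow>
     has_jump \<phi> 0 \<and> has_jump \<theta> 0 \<and> has_jump \<psi> 0 \<and>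
     has_jump (\<lambda>x. lam * \<epsilon>0 x * (deriv \<phi> x - \<xi>$1 * \<psi> x)) 0 \<and>
     has_jump (\<lambda>x. lam * \<epsilon>0 x * (deriv \<theta> x - \<xi>$2 * \<psi> x)) 0 \<and>
     (\<exists>J1 J2.
        has_jump (\<lambda>x. (lam * \<delta>0 x + lam * \<epsilon>0 x / 3 + dP0 x * \<rho>0 x) *
                      (deriv \<psi> x + \<xi>$1 * \<phi> x + \<xi>$2 * \<theta> x)) J1 \<and>
        has_jump (\<lambda>x. lam * \<epsilon>0 x * (deriv \<psi> x - \<xi>$1 * \<phi> x - \<xi>$2 * \<theta> x)) J2 \<and>
        J1 + J2 = \<sigma> * (norm \<xi>)\<^sup>2 * \<psi> 0)"

text \<open>The profiles live on the open interval \<open>(-m, l)\<close>, so boundary values are one-sided limits.\<close>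

definition vanishes_at_ends :: "real \<Rightarrow> real \<Rightarrow> (real \<Rightarrow> real) \<Rightarrow> bool" where
  "vanishes_at_ends m l f \<longleftrightarrow> (f \<longlongrightarrow> 0) (at_right (- m)) \<and> (f \<longlongrightarrow> 0) (at_left l)"

text \<open>Continuity at \<open>0\<close> makes the value at the interface, as in \<open>\<psi> 0 \<noteq> 0\<close>, the common one-sided limit.\<close>

definition profile :: "real \<Rightarrow> real \<Rightarrow> (real \<Rightarrow> real) \<Rightarrow> bool" where
  "profile m l f \<longleftrightarrow> smooth_on {-m<..<0} f \<and> smooth_on {0<..<l} f \<and> isCont f 0"

end

theory Submission
  imports Defs
begin

text \<open>
  Growing modes of the viscous compressible Rayleigh-Taylor problem are found by shooting and the
  intermediate value theorem instead of a constrained minimisation in a Sobolev space.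

  For the wave vector \<open>(k, 0)\<close> one can take \<open>\<theta> = 0\<close>, and all other wave vectors follow by rotation. The
  equations in one fluid then become a linear Hamiltonian system for the displacement \<open>(\<phi>, \<psi>)\<close> and the
  two tractions, with the growth rate \<open>\<lambda>\<close> (written \<open>lam\<close> in the formulas) as a parameter. In each
  fluid the solutions that vanish at the wall are determined by their interface value \<open>(\<phi>(0), \<psi>(0))\<close>, because the energy of displacements with \<open>\<psi>(0) = 0\<close> is positive
  (\<open>energy_eq\<close>, \<open>flow_dirichlet_unique\<close>). So each fluid has a symmetric \<open>2 \<times> 2\<close> matrix that maps
  interface values to tractions and depends continuously on \<open>\<lambda>\<close> (\<open>traction_matrix\<close>). The jump
  conditions ask for a null vector of the total matrix \<open>N(\<lambda>)\<close>, in which surface tension adds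
  \<open>\<sigma> k\<^sup>2\<close> to the lower right entry.

  For \<open>\<lambda>\<^sup>2 > g k\<close> inertia makes \<open>N(\<lambda>)\<close> positive definite (\<open>flow_traction_pos\<close>). For small \<open>\<lambda>\<close> an explicit
  test displacement, for which compression and buoyancy balance exactly, shows that its lower right
  entry is at most \<open>\<sigma> k\<^sup>2 - g [[\<rho>0]]\<close> up to an error of order \<open>\<lambda>\<close> (\<open>flow_traction_bound\<close>); this is
  negative below the critical wave number. Hence the determinant changes sign (\<open>growing_mode\<close>). At a zero
  of the determinant the null vector has \<open>\<psi>(0) \<noteq> 0\<close>, since the upper left entry is always positive.

  All energy identities appear as monotonicity of explicit functions of height, so no integration
  over the layers is needed. Smoothness in the interior follows by bootstrapping along the
  first-order system.
\<close>

section \<open>Linear differential equations with a parameter\<close>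

text \<open>Substituting \<open>t = a + r (x - a)\<close> moves the variable endpoint into the integrand, so that
  continuity under the integral sign applies.\<close>

lemma continuous_on_integral_upper_limit:
  fixes G :: "real \<Rightarrow> real \<Rightarrow> 'a::euclidean_space"
  assumes G: "continuous_on ({a..b} \<times> S) (\<lambda>(t, s). G t s)"
  shows "continuous_on ({a..b} \<times> S) (\<lambda>(x, s). integral {a..x} (\<lambda>t. G t s))"
proof -
  have eq: "integral {a..x} (\<lambda>t. G t s) = integral (cbox 0 1) (\<lambda>r. (x - a) *\<^sub>R G (a + r * (x - a)) s)"
    if "x \<in> {a..b}" "s \<in> S" for x s
  proof -
    have sub: "(\<lambda>r. a + r * (x - a)) ` {0..1} \<subseteq> {a..x}"
    proof (rule image_subsetI)
      fix r :: real assume "r \<in> {0..1}"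
      then have "0 \<le> r * (x - a)" "r * (x - a) \<le> x - a"
        using that mult_left_le_one_le[of "x - a" r] by auto
      then show "a + r * (x - a) \<in> {a..x}" by simp
    qed
    have "continuous_on {a..x} (\<lambda>t. G t s)"
      using that by (intro continuous_on_compose2[OF G, of "{a..x}" "\<lambda>t. (t, s)", simplified]) (auto intro!: continuous_intros)
    then have "((\<lambda>r. (x - a) *\<^sub>R G (a + r * (x - a)) s) has_integral
        integral {a + 0 * (x - a)..a + 1 * (x - a)} (\<lambda>t. G t s)) {0..1}"
      using that sub
      by (intro has_integral_substitution[where c = a and d = x])
         (auto intro!: derivative_eq_intros)
    then show ?thesis
      by (simp add: has_integral_iff)
  qed
  have "continuous_on ({a..b} \<times> S) (\<lambda>p. integral (cbox 0 1)
      (\<lambda>r. (fst p - a) *\<^sub>R G (a + r * (fst p - a)) (snd p)))"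
  proof (rule integral_continuous_on_param)
    have sub: "a + r * (x - a) \<in> {a..b}" if "x \<in> {a..b}" "r \<in> {0..1}" for x r
    proof -
      have "0 \<le> r * (x - a)" "r * (x - a) \<le> x - a"
        using that mult_left_le_one_le[of "x - a" r] by auto
      then show ?thesis using that by simp
    qed
    have "continuous_on (({a..b} \<times> S) \<times> cbox 0 1)
       (\<lambda>q. (\<lambda>(t, s). G t s) (a + snd q * (fst (fst q) - a), snd (fst q)))"
      using sub by (intro continuous_on_compose2[OF G]) (auto intro!: continuous_intros)
    then show "continuous_on (({a..b} \<times> S) \<times> cbox 0 1)
       (\<lambda>(p, r). (fst p - a) *\<^sub>R G (a + r * (fst p - a)) (snd p))"
      by (auto simp: case_prod_beta intro!: continuous_intros)
  qed
  then show ?thesis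
    by (subst continuous_on_cong[OF refl]) (auto simp: eq)
qed

text \<open>Homogeneity reduces the bound to the unit sphere, which is compact; this gives one Lipschitz
  constant for all parameters at once.\<close>

lemma linear_field_bound:
  fixes F :: "'p::topological_space \<Rightarrow> 'a::euclidean_space \<Rightarrow> 'b::real_normed_vector"
  assumes "compact D"
    and F: "continuous_on (D \<times> UNIV) (\<lambda>(p, y). F p y)"
    and lin: "\<And>p. p \<in> D \<Longrightarrow> linear (F p)"
  obtains K where "K > 0" "\<And>p y. p \<in> D \<Longrightarrow> norm (F p y) \<le> K * norm y"
proof -
  have "compact ((\<lambda>(p, y). F p y) ` (D \<times> sphere 0 1))"
    by (intro compact_continuous_image continuous_on_subset[OF F] compact_Times assms) auto
  then have "bounded ((\<lambda>(p, y). F p y) ` (D \<times> sphere 0 1))"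
    by (rule compact_imp_bounded)
  then obtain K where K: "K > 0" "\<And>z. z \<in> (\<lambda>(p, y). F p y) ` (D \<times> sphere 0 1) \<Longrightarrow> norm z \<le> K"
    unfolding bounded_pos by blast
  have "norm (F p y) \<le> K * norm y" if p: "p \<in> D" for p y
  proof (cases "y = 0")
    case True
    then show ?thesis using lin[OF p] by (simp add: linear_0)
  next
    case False
    have "F p y = norm y *\<^sub>R F p (y /\<^sub>R norm y)"
      using False by (simp add: linear_scale[OF lin[OF p]])
    moreover have "norm (F p (y /\<^sub>R norm y)) \<le> K"
      using p False by (intro K(2)) (auto intro!: image_eqI[of _ _ "(p, y /\<^sub>R norm y)"])
    ultimately show ?thesis
      by (simp add: mult.commute[of K] mult_left_mono)
  qed
  with K(1) show ?thesis using that by blast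
qed

text \<open>The fixed-point argument takes place in the space of continuous functions of the pair of
  variable and parameter, so that joint continuity of the solution needs no separate
  Gronwall estimate. The unknown is \<open>Z(x, s) = exp(-\<kappa> (x - a)) Y(x, s)\<close>: in this weighted variable
  the Picard map contracts by \<open>K / \<kappa>\<close> on the whole interval, where \<open>K\<close> is the Lipschitz constant.\<close>

lemma linear_ode_parametric_left:
  fixes F :: "real \<times> real \<Rightarrow> 'a::euclidean_space \<Rightarrow> 'a" and y0 :: 'a
  assumes ab: "a \<le> b" and cd: "c \<le> d"
    and F: "continuous_on (({a..b} \<times> {c..d}) \<times> UNIV) (\<lambda>(p, y). F p y)"
    and lin: "\<And>p. p \<in> {a..b} \<times> {c..d} \<Longrightarrow> linear (F p)"
  obtains Y where "continuous_on ({a..b} \<times> {c..d}) Y"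
    "\<And>s. s \<in> {c..d} \<Longrightarrow> Y (a, s) = y0"
    "\<And>x s. x \<in> {a..b} \<Longrightarrow> s \<in> {c..d} \<Longrightarrow>
      ((\<lambda>x. Y (x, s)) has_vector_derivative F (x, s) (Y (x, s))) (at x within {a..b})"
proof -
  let ?D = "{a..b} \<times> {c..d}"
  have D: "?D = cbox (a, c) (b, d)"
    by (auto simp: cbox_Pair_eq)
  obtain K where K: "K > 0" and FK: "\<And>p y. p \<in> ?D \<Longrightarrow> norm (F p y) \<le> K * norm y"
    using linear_field_bound[OF _ F lin] by (metis compact_Icc compact_Times)
  define \<kappa> where "\<kappa> = 2 * K"
  define G where "G Z t s = exp (\<kappa> * (t - a)) *\<^sub>R F (t, s) (apply_bcontfun Z (t, s))" for Z t s
  have GC: "continuous_on ?D (\<lambda>(t, s). G Z t s)" for Z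
  proof -
    have "continuous_on ?D (\<lambda>p. (\<lambda>(p, y). F p y) (p, apply_bcontfun Z p))"
      by (intro continuous_on_compose2[OF F]) (auto intro!: continuous_intros)
    then show ?thesis
      unfolding G_def case_prod_beta by (auto intro!: continuous_intros)
  qed
  have GI: "(\<lambda>t. G Z t s) integrable_on {a..x}" if "x \<in> {a..b}" "s \<in> {c..d}" for Z x s
    using that
    by (intro integrable_continuous_interval continuous_on_compose2[OF GC, of "{a..x}" "\<lambda>t. (t, s)", simplified])
       (auto intro!: continuous_intros)
  define T where "T Z = (\<lambda>(x, s). exp (- \<kappa> * (x - a)) *\<^sub>R (y0 + integral {a..x} (\<lambda>t. G Z t s)))" for Z
  have TC: "continuous_on ?D (T Z)" for Z
    using continuous_on_integral_upper_limit[OF GC[of Z]]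
    unfolding T_def case_prod_beta by (auto intro!: continuous_intros)
  \<comment> \<open>The Picard map is extended from the rectangle to the whole plane by clamping.\<close>
  have "\<forall>Z. \<exists>W::(real \<times> real) \<Rightarrow>\<^sub>C 'a. \<forall>p. W p = T Z (clamp (a, c) (b, d) p)"
  proof
    fix Z
    show "\<exists>W::(real \<times> real) \<Rightarrow>\<^sub>C 'a. \<forall>p. W p = T Z (clamp (a, c) (b, d) p)"
      using TC[of Z, unfolded D] by (elim continuous_on_cbox_bcontfunE) blast
  qed
  then obtain \<Phi> :: "((real \<times> real) \<Rightarrow>\<^sub>C 'a) \<Rightarrow> (real \<times> real) \<Rightarrow>\<^sub>C 'a"
    where \<Phi>: "\<And>Z p. \<Phi> Z p = T Z (clamp (a, c) (b, d) p)"
    by metis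
  have T_lip: "dist (T Z p) (T W p) \<le> 1/2 * dist Z W" if p: "p \<in> ?D" for Z W p
  proof -
    obtain x s where xs: "p = (x, s)" "x \<in> {a..b}" "s \<in> {c..d}"
      using p by auto
    have ex: "((\<lambda>t. exp (\<kappa> * (t - a)) * (K * dist Z W)) has_integral
        exp (\<kappa> * (x - a)) / \<kappa> * (K * dist Z W) - exp (\<kappa> * (a - a)) / \<kappa> * (K * dist Z W)) {a..x}"
      using xs K by (intro fundamental_theorem_of_calculus)
        (auto intro!: derivative_eq_intros simp: \<kappa>_def simp flip: has_real_derivative_iff_has_vector_derivative)
    have "norm (integral {a..x} (\<lambda>t. G Z t s) - integral {a..x} (\<lambda>t. G W t s))
        = norm (integral {a..x} (\<lambda>t. G Z t s - G W t s))"
      using xs by (simp add: GI Henstock_Kurzweil_Integration.integral_diff)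
    also have "\<dots> \<le> integral {a..x} (\<lambda>t. exp (\<kappa> * (t - a)) * (K * dist Z W))"
    proof (rule integral_norm_bound_integral)
      fix t assume t: "t \<in> {a..x}"
      then have ts: "(t, s) \<in> ?D" using xs by auto
      have "norm (G Z t s - G W t s) = exp (\<kappa> * (t - a)) * norm (F (t, s) (Z (t, s) - W (t, s)))"
        by (simp add: G_def linear_diff[OF lin[OF ts]] flip: scaleR_diff_right)
      also have "\<dots> \<le> exp (\<kappa> * (t - a)) * (K * norm (Z (t, s) - W (t, s)))"
        by (intro mult_left_mono FK ts) auto
      also have "\<dots> \<le> exp (\<kappa> * (t - a)) * (K * dist Z W)"
        using K dist_bounded[of Z "(t, s)" W] by (intro mult_left_mono) (auto simp: dist_norm)
      finally show "norm (G Z t s - G W t s) \<le> exp (\<kappa> * (t - a)) * (K * dist Z W)" .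
    qed (use xs ex in \<open>auto intro!: integrable_diff GI\<close>)
    also have "\<dots> = (exp (\<kappa> * (x - a)) - 1) / 2 * dist Z W"
      unfolding integral_unique[OF ex] using K by (simp add: \<kappa>_def field_simps)
    finally have "norm (T Z p - T W p) \<le> exp (- \<kappa> * (x - a)) * ((exp (\<kappa> * (x - a)) - 1) / 2 * dist Z W)"
      by (simp add: xs T_def flip: scaleR_diff_right)
    also have "\<dots> = (1 - exp (- \<kappa> * (x - a))) * (1 / 2 * dist Z W)"
    proof -
      have "exp (- \<kappa> * (x - a)) * exp (\<kappa> * (x - a)) = 1" by (simp flip: exp_add)
      then show ?thesis by (simp add: right_diff_distrib left_diff_distrib flip: mult.assoc)
    qed
    also have "\<dots> \<le> 1 * (1 / 2 * dist Z W)"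
      by (intro mult_right_mono) auto
    finally show ?thesis by (simp add: dist_norm)
  qed
  have "clamp (a, c) (b, d) p \<in> ?D" for p
    unfolding D using ab cd by (intro clamp_in_interval) (auto simp: Basis_prod_def)
  then have "dist (\<Phi> Z) (\<Phi> W) \<le> 1/2 * dist Z W" for Z W
    by (intro dist_bound) (auto simp only: \<Phi> T_lip)
  then have "\<exists>!Z. \<Phi> Z = Z"
    by (intro banach_fix_type[where c = "1/2"]) auto
  then obtain Z where Z: "\<Phi> Z = Z" by blast
  define Y where "Y = (\<lambda>(x, s). y0 + integral {a..x} (\<lambda>t. G Z t s))"
  have YZ: "Y p = exp (\<kappa> * (fst p - a)) *\<^sub>R Z p" if "p \<in> ?D" for p
  proof -
    have "Z p = T Z p"
      using \<Phi>[of Z p] Z that by (simp add: D)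
    then show ?thesis
      by (simp add: T_def Y_def case_prod_beta flip: exp_add)
  qed
  show ?thesis
  proof
    show "continuous_on ?D Y"
      using continuous_on_integral_upper_limit[OF GC[of Z]]
      unfolding Y_def case_prod_beta by (auto intro!: continuous_intros)
    show "Y (a, s) = y0" for s
      by (simp add: Y_def)
    fix x s assume xs: "x \<in> {a..b}" "s \<in> {c..d}"
    have "continuous_on {a..b} (\<lambda>t. G Z t s)"
      using xs by (intro continuous_on_compose2[OF GC, of "{a..b}" "\<lambda>t. (t, s)", simplified])
        (auto intro!: continuous_intros)
    then have "((\<lambda>x. y0 + integral {a..x} (\<lambda>t. G Z t s)) has_vector_derivative 0 + G Z x s) (at x within {a..b})"
      using xs by (intro has_vector_derivative_add has_vector_derivative_const integral_has_vector_derivative)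
    moreover have "G Z x s = F (x, s) (Y (x, s))"
      using xs by (simp add: G_def YZ linear_scale[OF lin])
    ultimately show "((\<lambda>x. Y (x, s)) has_vector_derivative F (x, s) (Y (x, s))) (at x within {a..b})"
      by (simp add: Y_def)
  qed
qed

text \<open>Initial data at the right end: reflect the interval.\<close>

lemma linear_ode_parametric_right:
  fixes F :: "real \<times> real \<Rightarrow> 'a::euclidean_space \<Rightarrow> 'a" and y0 :: 'a
  assumes ab: "a \<le> b" and cd: "c \<le> d"
    and F: "continuous_on (({a..b} \<times> {c..d}) \<times> UNIV) (\<lambda>(p, y). F p y)"
    and lin: "\<And>p. p \<in> {a..b} \<times> {c..d} \<Longrightarrow> linear (F p)"
  obtains Y where "continuous_on ({a..b} \<times> {c..d}) Y"
    "\<And>s. s \<in> {c..d} \<Longrightarrow> Y (b, s) = y0"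
    "\<And>x s. x \<in> {a..b} \<Longrightarrow> s \<in> {c..d} \<Longrightarrow>
      ((\<lambda>x. Y (x, s)) has_vector_derivative F (x, s) (Y (x, s))) (at x within {a..b})"
proof -
  define F' where "F' = (\<lambda>(x, s) y. - F (- x, s) y)"
  have F': "continuous_on (({-b..-a} \<times> {c..d}) \<times> UNIV) (\<lambda>(p, y). F' p y)"
  proof -
    have "continuous_on (({-b..-a} \<times> {c..d}) \<times> UNIV) 
       (\<lambda>q. - (\<lambda>(p, y). F p y) ((- fst (fst q), snd (fst q)), snd q))"
      by (intro continuous_on_minus continuous_on_compose2[OF F]) (auto intro!: continuous_intros)
    then show ?thesis by (simp add: F'_def case_prod_beta)
  qed
  have lin': "linear (F' p)" if "p \<in> {-b..-a} \<times> {c..d}" for p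
    using that unfolding F'_def by (cases p) (auto intro!: linear_compose_neg lin)
  obtain Y where Y: "continuous_on ({-b..-a} \<times> {c..d}) Y"
    "\<And>s. s \<in> {c..d} \<Longrightarrow> Y (-b, s) = y0"
    "\<And>x s. x \<in> {-b..-a} \<Longrightarrow> s \<in> {c..d} \<Longrightarrow>
      ((\<lambda>x. Y (x, s)) has_vector_derivative F' (x, s) (Y (x, s))) (at x within {-b..-a})"
    using linear_ode_parametric_left[OF _ cd F' lin', of y0] ab by auto
  show ?thesis
  proof (rule that[of "\<lambda>(x, s). Y (- x, s)"])
    show "continuous_on ({a..b} \<times> {c..d}) (\<lambda>(x, s). Y (- x, s))"
      unfolding case_prod_beta
      by (intro continuous_on_compose2[OF Y(1)]) (auto intro!: continuous_intros)
    show "s \<in> {c..d} \<Longrightarrow> (case (b, s) of (x, s) \<Rightarrow> Y (- x, s)) = y0" for s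
      using Y(2) by simp
    fix x s assume xs: "x \<in> {a..b}" "s \<in> {c..d}"
    have "((\<lambda>x. Y (x, s)) \<circ> uminus has_vector_derivative (- 1) *\<^sub>R F' (- x, s) (Y (- x, s))) (at x within {a..b})"
      using xs by (intro vector_diff_chain_within) (auto intro!: derivative_eq_intros Y(3))
    then show "((\<lambda>x. case (x, s) of (x, s) \<Rightarrow> Y (- x, s)) has_vector_derivative
        F (x, s) (case (x, s) of (x, s) \<Rightarrow> Y (- x, s))) (at x within {a..b})"
      by (simp add: o_def F'_def)
  qed
qed

section \<open>Smooth functions on open sets\<close>

text \<open>Asking only for some derivative at each stage, instead of the iterated total operator
  \<^const>\<open>deriv\<close>, makes the closure rules provable by one induction each. It also supports
  bootstrapping: if the derivative of \<open>f\<close> is an expression in \<open>f\<close>, differentiability of \<open>f\<close> of order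
  \<open>n\<close> yields order \<open>n + 1\<close>.\<close>

primrec times_differentiable_on :: "nat \<Rightarrow> real set \<Rightarrow> (real \<Rightarrow> real) \<Rightarrow> bool" where
  "times_differentiable_on 0 S f \<longleftrightarrow> True"
| "times_differentiable_on (Suc n) S f \<longleftrightarrow>
    (\<exists>f'. (\<forall>x\<in>S. (f has_real_derivative f' x) (at x)) \<and> times_differentiable_on n S f')"

lemma times_differentiable_on_cong:
  assumes "open S" "\<And>x. x \<in> S \<Longrightarrow> f x = g x" "times_differentiable_on n S f"
  shows "times_differentiable_on n S g"
proof (cases n)
  case (Suc k)
  with assms(3) obtain f' where f': "\<And>x. x \<in> S \<Longrightarrow> (f has_real_derivative f' x) (at x)"
    "times_differentiable_on k S f'"
    by auto
  have "(g has_real_derivative f' x) (at x)" if "x \<in> S" for x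
    using has_field_derivative_transform_within_open[OF f'(1)[OF that] assms(1) that] assms(2) by simp
  with f'(2) Suc show ?thesis by auto
qed simp

lemma times_differentiable_on_SucD:
  "times_differentiable_on (Suc n) S f \<Longrightarrow> times_differentiable_on n S f"
  by (induction n arbitrary: f) (simp, metis times_differentiable_on.simps(2))

lemma times_differentiable_on_subset:
  "times_differentiable_on n S f \<Longrightarrow> T \<subseteq> S \<Longrightarrow> times_differentiable_on n T f"
  by (induction n arbitrary: f) (simp, metis subsetD times_differentiable_on.simps(2))

lemma times_differentiable_on_SucI:
  "(\<And>x. x \<in> S \<Longrightarrow> (f has_real_derivative f' x) (at x)) \<Longrightarrow> times_differentiable_on n S f' \<Longrightarrow>
    times_differentiable_on (Suc n) S f"
  by auto

lemma times_differentiable_on_const [simp]: "times_differentiable_on n S (\<lambda>x. c)"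
  by (induction n arbitrary: c) (auto intro!: exI[of _ "\<lambda>x. 0"])

lemma times_differentiable_on_add:
  "times_differentiable_on n S f \<Longrightarrow> times_differentiable_on n S g \<Longrightarrow>
    times_differentiable_on n S (\<lambda>x. f x + g x)"
proof (induction n arbitrary: f g)
  case (Suc n)
  then obtain f' g' where "\<And>x. x \<in> S \<Longrightarrow> (f has_real_derivative f' x) (at x)"
    "\<And>x. x \<in> S \<Longrightarrow> (g has_real_derivative g' x) (at x)"
    "times_differentiable_on n S f'" "times_differentiable_on n S g'"
    unfolding times_differentiable_on.simps by metis
  then show ?case
    by (auto intro!: exI[of _ "\<lambda>x. f' x + g' x"] derivative_eq_intros Suc.IH)
qed simp

lemma times_differentiable_on_mult:
  "times_differentiable_on n S f \<Longrightarrow> times_differentiable_on n S g \<Longrightarrow>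
    times_differentiable_on n S (\<lambda>x. f x * g x)"
proof (induction n arbitrary: f g)
  case (Suc n)
  note td = times_differentiable_on_SucD[OF Suc.prems(1)] times_differentiable_on_SucD[OF Suc.prems(2)]
  obtain f' g' where "\<And>x. x \<in> S \<Longrightarrow> (f has_real_derivative f' x) (at x)"
    "\<And>x. x \<in> S \<Longrightarrow> (g has_real_derivative g' x) (at x)"
    "times_differentiable_on n S f'" "times_differentiable_on n S g'"
    using Suc.prems by auto
  then show ?case using td
    by (auto intro!: exI[of _ "\<lambda>x. f' x * g x + f x * g' x"] derivative_eq_intros
        times_differentiable_on_add Suc.IH)
qed simp

lemma times_differentiable_on_minus:
  "times_differentiable_on n S f \<Longrightarrow> times_differentiable_on n S (\<lambda>x. - f x)"
  using times_differentiable_on_mult[of n S "\<lambda>x. -1" f] by simp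

lemma times_differentiable_on_diff:
  "times_differentiable_on n S f \<Longrightarrow> times_differentiable_on n S g \<Longrightarrow>
    times_differentiable_on n S (\<lambda>x. f x - g x)"
  using times_differentiable_on_add[of n S f "\<lambda>x. - g x"] times_differentiable_on_minus[of n S g]
  by simp

lemma times_differentiable_on_inverse:
  assumes "\<And>x. x \<in> S \<Longrightarrow> f x \<noteq> 0"
  shows "times_differentiable_on n S f \<Longrightarrow> times_differentiable_on n S (\<lambda>x. inverse (f x))"
proof (induction n)
  case (Suc n)
  note IH = Suc.IH[OF times_differentiable_on_SucD[OF Suc.prems]]
  obtain f' where "\<And>x. x \<in> S \<Longrightarrow> (f has_real_derivative f' x) (at x)"
    "times_differentiable_on n S f'"
    using Suc.prems by auto
  then show ?case using IH assms
    by (auto intro!: exI[of _ "\<lambda>x. - (inverse (f x) * f' x * inverse (f x))"] derivative_eq_intros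
        times_differentiable_on_mult times_differentiable_on_minus)
qed simp

lemma times_differentiable_on_divide:
  assumes "\<And>x. x \<in> S \<Longrightarrow> g x \<noteq> 0"
    "times_differentiable_on n S f" "times_differentiable_on n S g"
  shows "times_differentiable_on n S (\<lambda>x. f x / g x)"
  unfolding divide_inverse
  by (intro times_differentiable_on_mult times_differentiable_on_inverse assms)

lemma times_differentiable_on_compose:
  assumes "\<And>x. x \<in> S \<Longrightarrow> g x \<in> T"
  shows "times_differentiable_on n T f \<Longrightarrow> times_differentiable_on n S g \<Longrightarrow>
    times_differentiable_on n S (\<lambda>x. f (g x))"
proof (induction n arbitrary: f)
  case (Suc n)
  obtain f' g' where f': "\<And>x. x \<in> T \<Longrightarrow> (f has_real_derivative f' x) (at x)"
    and g': "\<And>x. x \<in> S \<Longrightarrow> (g has_real_derivative g' x) (at x)"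
    and n: "times_differentiable_on n T f'" "times_differentiable_on n S g'"
    using Suc.prems by auto
  have "((\<lambda>x. f (g x)) has_real_derivative f' (g x) * g' x) (at x)" if "x \<in> S" for x
    using DERIV_chain2[OF f'[OF assms[OF that]] g'[OF that]] .
  moreover have "times_differentiable_on n S (\<lambda>x. f' (g x) * g' x)"
    by (rule times_differentiable_on_mult[OF Suc.IH[OF n(1) times_differentiable_on_SucD[OF Suc.prems(2)]] n(2)])
  ultimately show ?case
    by (auto intro!: exI[of _ "\<lambda>x. f' (g x) * g' x"])
qed simp

lemmas times_differentiable_intros = times_differentiable_on_const times_differentiable_on_add
  times_differentiable_on_mult times_differentiable_on_minus times_differentiable_on_diff
  times_differentiable_on_divide

lemma smooth_on_has_derivative:
  "smooth_on S f \<Longrightarrow> x \<in> S \<Longrightarrow> (f has_real_derivative deriv f x) (at x)"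
  unfolding smooth_on_def by (metis DERIV_deriv_iff_field_differentiable funpow_0)

lemma smooth_on_deriv: "smooth_on S f \<Longrightarrow> smooth_on S (deriv f)"
  unfolding smooth_on_def by (metis comp_apply funpow_Suc_right)

lemma smooth_on_imp_times_differentiable_on:
  "smooth_on S f \<Longrightarrow> times_differentiable_on n S f"
  by (induction n arbitrary: f) (auto intro: smooth_on_has_derivative smooth_on_deriv)

lemma times_differentiable_on_imp_funpow_deriv:
  assumes "open S"
  shows "times_differentiable_on (Suc n) S f \<Longrightarrow> x \<in> S \<Longrightarrow> (deriv ^^ n) f field_differentiable at x"
proof (induction n arbitrary: f)
  case 0
  then show ?case by (auto simp: field_differentiable_def)
next
  case (Suc n)
  then obtain f' where f': "\<And>x. x \<in> S \<Longrightarrow> (f has_real_derivative f' x) (at x)"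
    "times_differentiable_on (Suc n) S f'"
    by (metis times_differentiable_on.simps(2))
  have "times_differentiable_on (Suc n) S (deriv f)"
    using f'(1) by (intro times_differentiable_on_cong[OF assms _ f'(2)]) (metis DERIV_imp_deriv)
  then show ?case
    using Suc.IH Suc.prems(2) by (simp add: funpow_swap1)
qed

lemma smooth_on_iff:
  "open S \<Longrightarrow> smooth_on S f \<longleftrightarrow> (\<forall>n. times_differentiable_on n S f)"
  using smooth_on_imp_times_differentiable_on times_differentiable_on_imp_funpow_deriv
  by (auto simp: smooth_on_def simp del: times_differentiable_on.simps)

lemma smooth_on_continuous_on: "smooth_on S f \<Longrightarrow> continuous_on S f"
  by (auto intro!: continuous_at_imp_continuous_on intro: DERIV_isCont smooth_on_has_derivative)

section \<open>Hydrostatic equilibrium\<close>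

text \<open>A zero of the continuous function \<open>P'\<close> would make \<open>1 / P'\<close> exceed every bound on an interval, a set
  of positive measure, against local essential boundedness.\<close>

lemma pressure_law_deriv_pos:
  assumes P: "pressure_law P" and "z > 0"
  shows "deriv P z > 0"
proof (rule ccontr)
  assume neg: "\<not> deriv P z > 0"
  have sm: "smooth_on {0<..} P" and mono: "strict_mono_on {0<..} P"
    and nz: "AE z in lborel. z \<in> {0<..} \<longrightarrow> deriv P z \<noteq> 0"
    and Linf: "Linfty_loc {0<..} (\<lambda>z. 1 / deriv P z)"
    using P by (auto simp: pressure_law_def)
  obtain C where C: "AE x in lborel. x \<in> {z / 2..2 * z} \<longrightarrow> \<bar>1 / deriv P x\<bar> \<le> C"
  proof -
    have "compact {z / 2..2 * z} \<and> {z / 2..2 * z} \<subseteq> {0<..}"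
      using \<open>z > 0\<close> by auto
    with Linf show ?thesis
      using that unfolding Linfty_loc_def by blast
  qed
  have "continuous_on {0<..} (deriv P)"
    by (intro smooth_on_continuous_on smooth_on_deriv sm)
  then have "isCont (deriv P) z"
    using \<open>z > 0\<close> by (simp add: continuous_on_eq_continuous_at)
  moreover have "deriv P z < 1 / (\<bar>C\<bar> + 1)"
    using neg by (smt (verit) divide_pos_pos)
  ultimately have "\<forall>\<^sub>F x in at z. deriv P x < 1 / (\<bar>C\<bar> + 1)"
    by (simp add: isCont_def order_tendsto_iff)
  then obtain e where e: "e > 0" "\<And>x. x \<noteq> z \<Longrightarrow> dist x z < e \<Longrightarrow> deriv P x < 1 / (\<bar>C\<bar> + 1)"
    unfolding eventually_at by auto
  define b where "b = min (2 * z) (z + e)"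
  have zb: "z < b" using \<open>z > 0\<close> e(1) by (simp add: b_def)
  have mon: "mono_on {0<..} P"
    using mono by (rule strict_mono_on_imp_mono_on)
  have nonneg: "deriv P x \<ge> 0" if "x > 0" for x
    using mono_on_imp_deriv_nonneg[OF mon smooth_on_has_derivative[OF sm]] that
    by (simp add: interior_open)
  have "AE x in lborel. x \<notin> {z<..<b}"
    using C nz
  proof eventually_elim
    case (elim x)
    note Cx = elim(1) and nzx = elim(2)
    show ?case
    proof
    assume x: "x \<in> {z<..<b}"
    have pos: "deriv P x > 0"
      using nonneg[of x] nzx x \<open>z > 0\<close> by force
    have "1 / deriv P x \<le> C"
      using Cx x \<open>z > 0\<close> pos by (auto simp: b_def)
    moreover have "deriv P x < 1 / (\<bar>C\<bar> + 1)"
      using x by (intro e(2)) (auto simp: b_def dist_real_def)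
    ultimately show False
      using pos by (simp add: field_simps) (smt (verit) mult_less_cancel_left_pos mult.commute)
    qed
  qed
  then have "emeasure lborel {z<..<b} = 0"
    by (simp add: AE_iff_measurable[OF _ refl] greaterThanLessThan_def greaterThan_def lessThan_def Int_def)
  then show False using zb by simp
qed

lemma enthalpy_has_derivative:
  assumes P: "pressure_law P" and "z > 0"
  shows "(enthalpy P has_real_derivative deriv P z / z) (at z)"
proof -
  define a b where "a = min 1 z / 2" and "b = max 1 z + 1"
  have ab: "0 < a" "a \<le> 1" "1 \<le> b" "a < z" "z < b"
    using \<open>z > 0\<close> by (auto simp: a_def b_def)
  have "continuous_on {0<..} (deriv P)"
    using P by (intro smooth_on_continuous_on smooth_on_deriv) (simp add: pressure_law_def)
  then have "continuous_on {a..b} (\<lambda>r. deriv P r / r)"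
    using ab by (auto intro!: continuous_intros intro: continuous_on_subset)
  then have "((\<lambda>u. LBINT r=ereal 1..ereal u. deriv P r / r) has_vector_derivative deriv P z / z) (at z within {a..b})"
    using ab by (intro interval_integral_FTC2) auto
  then show ?thesis
    using ab by (simp add: enthalpy_def[abs_def] at_within_Icc_at has_real_derivative_iff_has_vector_derivative)
qed

text \<open>The enthalpy is strictly increasing with nonvanishing derivative \<open>P'(z) / z\<close>, so its range is an
  open interval and the profile extends a little beyond the layer. Differentiating
  \<open>h(r(x)) = h(r0) - g x\<close> gives hydrostatic balance.\<close>

lemma hydrostatic_density:
  assumes P: "pressure_law P" and r0: "r0 > 0"
    and w: "enthalpy P r0 - g * w \<in> enthalpy P ` {0<..}"
  defines "r \<equiv> \<lambda>x. the_inv_into {0<..} (enthalpy P) (enthalpy P r0 - g * x)"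
  obtains I where "open I" "closed_segment w 0 \<subseteq> I" "r 0 = r0"
    "\<And>x. x \<in> I \<Longrightarrow> r x > 0"
    "\<And>x. x \<in> I \<Longrightarrow> (r has_real_derivative - g * r x / deriv P (r x)) (at x)"
proof -
  let ?h = "enthalpy P"
  have pos: "deriv P z / z > 0" if "z > 0" for z
    using pressure_law_deriv_pos[OF P that] that by simp
  have mono: "strict_mono_on {0<..} ?h"
  proof (rule strict_mono_onI)
    fix x y :: real assume xy: "x \<in> {0<..}" "x < y"
    show "?h x < ?h y"
    proof (rule DERIV_pos_imp_increasing[OF xy(2)])
      fix t assume "x \<le> t"
      then have "t > 0" using xy by simp
      then show "\<exists>d. (?h has_real_derivative d) (at t) \<and> d > 0"
        by (intro exI[of _ "deriv P t / t"] conjI enthalpy_has_derivative[OF P] pos)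
    qed
  qed
  have inj: "inj_on ?h {0<..}"
    using mono by (rule strict_mono_on_imp_inj_on)
  have cont: "continuous_on {0<..} ?h"
    using enthalpy_has_derivative[OF P] by (auto intro!: continuous_at_imp_continuous_on intro: DERIV_isCont)
  have op: "open (?h ` {0<..})"
    by (intro injective_into_1d_imp_open_map_UNIV[where S = "{0<..}"] cont inj) auto
  define I where "I = (\<lambda>x. ?h r0 - g * x) -` (?h ` {0<..})"
  have I: "r x \<in> {0<..}" "?h (r x) = ?h r0 - g * x" if "x \<in> I" for x
    using that inj unfolding I_def r_def by (auto simp: the_inv_into_f_f)
  have conv: "convex (?h ` {0<..})"
    by (metis connected_continuous_image[OF cont] connected_Ioi is_interval_connected_1 is_interval_convex_1)
  show ?thesis
  proof
    show "open I"
      unfolding I_def by (intro open_vimage op continuous_intros)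
    have "convex I"
    proof (rule convexI)
      fix x y u v :: real assume xy: "x \<in> I" "y \<in> I" and uv: "0 \<le> u" "0 \<le> v" "u + v = 1"
      have "u *\<^sub>R (?h r0 - g * x) + v *\<^sub>R (?h r0 - g * y) \<in> ?h ` {0<..}"
        using xy uv by (intro convexD[OF conv]) (auto simp: I_def)
      moreover have "u *\<^sub>R (?h r0 - g * x) + v *\<^sub>R (?h r0 - g * y) = ?h r0 - g * (u *\<^sub>R x + v *\<^sub>R y)"
      proof -
        have u: "u = 1 - v" using uv by simp
        show ?thesis unfolding u by (simp add: algebra_simps)
      qed
      ultimately show "u *\<^sub>R x + v *\<^sub>R y \<in> I"
        by (simp add: I_def)
    qed
    moreover have "w \<in> I" "0 \<in> I"
      using w r0 by (auto simp: I_def)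
    ultimately show "closed_segment w 0 \<subseteq> I"
      by (simp add: closed_segment_subset)
    show "r 0 = r0"
      using inj r0 by (simp add: r_def the_inv_into_f_f)
    fix x assume x: "x \<in> I"
    show rx: "r x > 0" using I[OF x] by simp
    have "(the_inv_into {0<..} ?h has_derivative (*) (r x / deriv P (r x))) (at (?h (r x)))"
      using rx pressure_law_deriv_pos[OF P rx] inj enthalpy_has_derivative[OF P rx, THEN has_field_derivative_imp_has_derivative]
      by (intro has_derivative_inverse_strong[of "{0<..}" "r x" ?h _ "(*) (deriv P (r x) / r x)"] cont)
         (auto simp: the_inv_into_f_f o_def fun_eq_iff)
    then have "(the_inv_into {0<..} ?h has_real_derivative (r x / deriv P (r x))) (at (?h r0 - g * x))"
      using I(2)[OF x] by (simp add: has_field_derivative_def)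
    then have "((\<lambda>x. the_inv_into {0<..} ?h (?h r0 - g * x)) has_real_derivative (r x / deriv P (r x)) * (- g)) (at x)"
      by (rule DERIV_chain2) (auto intro!: derivative_eq_intros)
    then show "(r has_real_derivative - g * r x / deriv P (r x)) (at x)"
      unfolding r_def[symmetric] by (simp add: mult.commute)
  qed
qed

text \<open>Bootstrapping along the balance equation, which avoids a smooth inverse function theorem.\<close>

lemma hydrostatic_density_times_differentiable:
  assumes P: "smooth_on {0<..} P" and pos: "\<And>z. z > 0 \<Longrightarrow> deriv P z > 0" "\<And>x. x \<in> I \<Longrightarrow> r x > 0"
    and r: "\<And>x. x \<in> I \<Longrightarrow> (r has_real_derivative - g * r x / deriv P (r x)) (at x)"
  shows "times_differentiable_on n I r"
proof (induction n)
  case (Suc n)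
  have "times_differentiable_on n I (\<lambda>x. deriv P (r x))"
    using pos by (intro times_differentiable_on_compose[where f = "deriv P" and g = r and T = "{0<..}", OF _ _ Suc]
        smooth_on_imp_times_differentiable_on[OF smooth_on_deriv[OF P]]) auto
  then have "times_differentiable_on n I (\<lambda>x. - g * r x / deriv P (r x))"
    using Suc pos by (intro times_differentiable_intros) (metis less_irrefl)
  then show ?case
    unfolding times_differentiable_on.simps using r by (intro exI[of _ "\<lambda>x. - g * r x / deriv P (r x)"]) auto
qed simp

section \<open>One fluid layer\<close>

lemma has_real_derivative_within_Icc_nonneg_imp_le:
  fixes F F' :: "real \<Rightarrow> real"
  assumes "a \<le> b" "\<And>x. x \<in> {a..b} \<Longrightarrow> (F has_real_derivative F' x) (at x within {a..b})"
    "\<And>x. x \<in> {a..b} \<Longrightarrow> 0 \<le> F' x"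
  shows "F a \<le> F b"
proof (cases "a < b")
  case True
  have "\<exists>x\<in>{a<..<b}. F b - F a = F' x * (b - a)"
    using assms(2) by (intro mvt_simple[OF True]) (auto simp: has_field_derivative_def)
  then show ?thesis
    using assms(3) True by (metis diff_ge_0_iff_ge greaterThanLessThan_subseteq_atLeastAtMost_iff less_eq_real_def mult_nonneg_nonneg order_refl subsetD)
qed (use assms(1) in auto)

lemma has_real_derivative_transform:
  fixes F G :: "real \<Rightarrow> real"
  assumes "x \<in> S" "\<And>z. z \<in> S \<Longrightarrow> G z = F z" "(F has_real_derivative D) (at x within S)"
  shows "(G has_real_derivative D) (at x within S)"
  using assms has_derivative_transform unfolding has_field_derivative_def by blast

type_synonym mode_state = "real \<times> real \<times> real \<times> real"

text \<open>One fluid, occupying the segment between the rigid wall \<open>x = w\<close> and the interface \<open>x = 0\<close>; the sign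
  of \<open>w\<close> decides whether it is the lower or the upper one. The coefficients are functions of height:
  density \<open>\<rho>\<close>, \<open>Q = P'(\<rho>)\<close>, shear viscosity \<open>e\<close> and bulk viscosity \<open>d\<close>.\<close>

locale fluid_layer =
  fixes g k w :: real and \<rho> Q e d :: "real \<Rightarrow> real"
  assumes g: "0 < g" and k: "0 < k" and w: "w \<noteq> 0"
    and \<rho>_pos: "\<And>x. x \<in> {min w 0..max w 0} \<Longrightarrow> 0 < \<rho> x"
    and Q_pos: "\<And>x. x \<in> {min w 0..max w 0} \<Longrightarrow> 0 < Q x"
    and e_pos: "\<And>x. x \<in> {min w 0..max w 0} \<Longrightarrow> 0 < e x"
    and d_nonneg: "\<And>x. x \<in> {min w 0..max w 0} \<Longrightarrow> 0 \<le> d x"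
    and Q_cont: "continuous_on {min w 0..max w 0} Q"
    and e_cont: "continuous_on {min w 0..max w 0} e"
    and d_cont: "continuous_on {min w 0..max w 0} d"
    and hydrostatic: "\<And>x. x \<in> {min w 0..max w 0} \<Longrightarrow>
      (\<rho> has_real_derivative - g * \<rho> x / Q x) (at x within {min w 0..max w 0})"
begin

abbreviation layer :: "real set" where "layer \<equiv> {min w 0..max w 0}"

text \<open>The direction from the wall to the interface. It is also the sign with which the tractions of the
  layer enter the force balance there: \<open>1\<close> for the lower fluid, \<open>-1\<close> for the upper one.\<close>

definition orientation :: real where "orientation = - sgn w"

text \<open>The coefficient \<open>\<lambda>\<delta> + \<lambda>\<epsilon>/3 + P'(\<rho>)\<rho>\<close> that multiplies the divergence in the mode equations.\<close>

definition bulk :: "real \<Rightarrow> real \<Rightarrow> real" where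
  "bulk lam x = lam * d x + lam * e x / 3 + Q x * \<rho> x"

text \<open>For the planar wave vector \<open>(k, 0)\<close> the equations for \<open>(\<phi>, \<psi>)\<close> become a first-order system in the
  state \<open>(\<phi>, \<psi>, p, q)\<close>, where \<open>p = \<lambda>\<epsilon> (\<phi>' - k \<psi>)\<close> and \<open>q = A (\<psi>' + k \<phi>) + \<lambda>\<epsilon> (\<psi>' - k \<phi>)\<close>, with \<open>A\<close> the
  coefficient \<^term>\<open>bulk\<close>, are the tangential and normal tractions. These are exactly the
  quantities in the jump conditions, and no derivative of a viscosity appears in the system. The
  next two functions solve for \<open>\<phi>'\<close> and \<open>\<psi>'\<close>.\<close>

definition dphi :: "real \<Rightarrow> real \<Rightarrow> mode_state \<Rightarrow> real" where
  "dphi lam x = (\<lambda>(\<phi>, \<psi>, p, q). p / (lam * e x) + k * \<psi>)"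

definition dpsi :: "real \<Rightarrow> real \<Rightarrow> mode_state \<Rightarrow> real" where
  "dpsi lam x = (\<lambda>(\<phi>, \<psi>, p, q). (q - k * (bulk lam x - lam * e x) * \<phi>) / (bulk lam x + lam * e x))"

definition mode_field :: "real \<Rightarrow> real \<Rightarrow> mode_state \<Rightarrow> mode_state" where
  "mode_field lam x = (\<lambda>(\<phi>, \<psi>, p, q). (dphi lam x (\<phi>, \<psi>, p, q), dpsi lam x (\<phi>, \<psi>, p, q),
      (lam\<^sup>2 * \<rho> x + lam * e x * k\<^sup>2 + k\<^sup>2 * bulk lam x) * \<phi>
        + k * (bulk lam x - lam * e x) * dpsi lam x (\<phi>, \<psi>, p, q) - g * k * \<rho> x * \<psi>,
      (lam\<^sup>2 * \<rho> x + lam * e x * k\<^sup>2) * \<psi> - g * k * \<rho> x * \<phi> - k * lam * e x * dphi lam x (\<phi>, \<psi>, p, q)))"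

definition flow :: "real \<Rightarrow> (real \<Rightarrow> mode_state) \<Rightarrow> bool" where
  "flow lam y \<longleftrightarrow> (\<forall>x\<in>layer. (y has_vector_derivative mode_field lam x (y x)) (at x within layer))"

abbreviation phi :: "(real \<Rightarrow> mode_state) \<Rightarrow> real \<Rightarrow> real" where "phi y x \<equiv> fst (y x)"
abbreviation psi :: "(real \<Rightarrow> mode_state) \<Rightarrow> real \<Rightarrow> real" where "psi y x \<equiv> fst (snd (y x))"
abbreviation tangential :: "(real \<Rightarrow> mode_state) \<Rightarrow> real \<Rightarrow> real" where "tangential y x \<equiv> fst (snd (snd (y x)))"
abbreviation normal :: "(real \<Rightarrow> mode_state) \<Rightarrow> real \<Rightarrow> real" where "normal y x \<equiv> snd (snd (snd (y x)))"

lemma layer_ends: "w \<in> layer" "0 \<in> layer" and layer_le: "min w 0 < max w 0"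
  using w by auto

lemma bulk_pos:
  assumes "0 < lam" "x \<in> layer"
  shows "0 < bulk lam x"
  unfolding bulk_def using assms
  by (intro add_nonneg_pos add_nonneg_nonneg mult_pos_pos \<rho>_pos Q_pos)
     (auto intro!: mult_nonneg_nonneg d_nonneg less_imp_le[OF e_pos])

lemma \<rho>_cont: "continuous_on layer \<rho>"
  using hydrostatic by (rule DERIV_continuous_on)

lemma linear_mode_field: "linear (mode_field lam x)"
  by (rule linearI)
     (auto simp: mode_field_def dphi_def dpsi_def split_beta algebra_simps add_divide_distrib diff_divide_distrib)

lemma continuous_on_mode_field:
  assumes "0 < lo"
  shows "continuous_on ((layer \<times> {lo..hi}) \<times> UNIV) (\<lambda>(p, y). mode_field (snd p) (fst p) y)"
proof -
  let ?S = "(layer \<times> {lo..hi}) \<times> (UNIV :: mode_state set)"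
  have c: "continuous_on ?S (\<lambda>z. f (fst (fst z)))" if "continuous_on layer f" for f :: "real \<Rightarrow> real"
    by (rule continuous_on_compose2[OF that]) (auto intro!: continuous_intros)
  note cs = c[OF \<rho>_cont] c[OF Q_cont] c[OF e_cont] c[OF d_cont]
  have b: "continuous_on ?S (\<lambda>z. bulk (snd (fst z)) (fst (fst z)))"
    unfolding bulk_def by (intro continuous_intros cs) auto
  have nz1: "\<forall>z\<in>?S. bulk (snd (fst z)) (fst (fst z)) + snd (fst z) * e (fst (fst z)) \<noteq> 0"
  proof
    fix z assume "z \<in> ?S"
    then have "snd (fst z) > 0" "fst (fst z) \<in> layer" using assms by auto
    then show "bulk (snd (fst z)) (fst (fst z)) + snd (fst z) * e (fst (fst z)) \<noteq> 0"
      by (smt (verit) bulk_pos e_pos mult_pos_pos)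
  qed
  have nz2: "\<forall>z\<in>?S. snd (fst z) * e (fst (fst z)) \<noteq> 0"
  proof
    fix z assume "z \<in> ?S"
    then have "snd (fst z) > 0" "fst (fst z) \<in> layer" using assms by auto
    then show "snd (fst z) * e (fst (fst z)) \<noteq> 0"
      by (smt (verit) e_pos mult_pos_pos)
  qed
  show ?thesis
    unfolding mode_field_def dphi_def dpsi_def case_prod_beta
    by (intro continuous_intros cs b nz1 nz2)
qed

lemma flow_lincomb:
  assumes "flow lam y" "flow lam z"
  shows "flow lam (\<lambda>x. \<alpha> *\<^sub>R y x + \<beta> *\<^sub>R z x)"
  unfolding flow_def
proof
  fix x assume x: "x \<in> layer"
  have "((\<lambda>x. \<alpha> *\<^sub>R y x + \<beta> *\<^sub>R z x) has_vector_derivative \<alpha> *\<^sub>R mode_field lam x (y x) + \<beta> *\<^sub>R mode_field lam x (z x)) (at x within layer)"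
    using assms x unfolding flow_def
    by (intro has_vector_derivative_add bounded_linear.has_vector_derivative[OF bounded_linear_scaleR_right]) auto
  then show "((\<lambda>x. \<alpha> *\<^sub>R y x + \<beta> *\<^sub>R z x) has_vector_derivative mode_field lam x (\<alpha> *\<^sub>R y x + \<beta> *\<^sub>R z x)) (at x within layer)"
    by (simp add: linear_add[OF linear_mode_field] linear_scale[OF linear_mode_field])
qed

lemma flow_components:
  assumes "flow lam y" "x \<in> layer"
  shows "(phi y has_real_derivative dphi lam x (y x)) (at x within layer)"
    "(psi y has_real_derivative dpsi lam x (y x)) (at x within layer)"
    "(tangential y has_real_derivative
      (lam\<^sup>2 * \<rho> x + lam * e x * k\<^sup>2 + k\<^sup>2 * bulk lam x) * phi y x
        + k * (bulk lam x - lam * e x) * dpsi lam x (y x) - g * k * \<rho> x * psi y x) (at x within layer)"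
    "(normal y has_real_derivative
      (lam\<^sup>2 * \<rho> x + lam * e x * k\<^sup>2) * psi y x - g * k * \<rho> x * phi y x - k * lam * e x * dphi lam x (y x))
      (at x within layer)"
proof -
  have y: "(y has_vector_derivative mode_field lam x (y x)) (at x within layer)"
    using assms by (simp add: flow_def)
  show "(phi y has_real_derivative dphi lam x (y x)) (at x within layer)"
    using bounded_linear.has_vector_derivative[OF bounded_linear_fst y]
    by (simp add: has_real_derivative_iff_has_vector_derivative mode_field_def split_beta)
  note y1 = bounded_linear.has_vector_derivative[OF bounded_linear_snd y]
  show "(psi y has_real_derivative dpsi lam x (y x)) (at x within layer)"
    using bounded_linear.has_vector_derivative[OF bounded_linear_fst y1]
    by (simp add: has_real_derivative_iff_has_vector_derivative mode_field_def split_beta)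
  note y2 = bounded_linear.has_vector_derivative[OF bounded_linear_snd y1]
  show "(tangential y has_real_derivative
      (lam\<^sup>2 * \<rho> x + lam * e x * k\<^sup>2 + k\<^sup>2 * bulk lam x) * phi y x
        + k * (bulk lam x - lam * e x) * dpsi lam x (y x) - g * k * \<rho> x * psi y x) (at x within layer)"
    using bounded_linear.has_vector_derivative[OF bounded_linear_fst y2]
    by (simp add: has_real_derivative_iff_has_vector_derivative mode_field_def split_beta)
  show "(normal y has_real_derivative
      (lam\<^sup>2 * \<rho> x + lam * e x * k\<^sup>2) * psi y x - g * k * \<rho> x * phi y x - k * lam * e x * dphi lam x (y x))
      (at x within layer)"
    using bounded_linear.has_vector_derivative[OF bounded_linear_snd y2]
    by (simp add: has_real_derivative_iff_has_vector_derivative mode_field_def split_beta)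
qed

lemma layer_mono:
  assumes "\<And>x. x \<in> layer \<Longrightarrow> (F has_real_derivative F' x) (at x within layer)"
    "\<And>x. x \<in> layer \<Longrightarrow> 0 \<le> F' x"
  shows "orientation * F w \<le> orientation * F 0"
proof -
  have "F (min w 0) \<le> F (max w 0)"
    by (rule has_real_derivative_within_Icc_nonneg_imp_le[OF _ assms]) auto
  then show ?thesis using w by (auto simp: orientation_def sgn_if min_def max_def split: if_splits)
qed

lemma layer_derivative_unique:
  assumes "x \<in> layer" "(F has_real_derivative a) (at x within layer)"
    "(F has_real_derivative b) (at x within layer)"
  shows "a = b"
  using assms layer_le
  by (metis box_real(2) has_real_derivative_iff_has_vector_derivative vector_derivative_unique_within_closed_interval)

text \<open>The equality case: a nondecreasing function that does not increase between its ends is constant.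
  Strict inequalities and uniqueness below all come from here.\<close>

lemma layer_derivative_zero:
  assumes F: "\<And>x. x \<in> layer \<Longrightarrow> (F has_real_derivative F' x) (at x within layer)"
    and nonneg: "\<And>x. x \<in> layer \<Longrightarrow> 0 \<le> F' x" and ends: "orientation * F 0 \<le> orientation * F w" and x: "x \<in> layer"
  shows "F' x = 0"
proof -
  have le: "F a \<le> F b" if "a \<in> layer" "b \<in> layer" "a \<le> b" for a b
    using that
    by (intro has_real_derivative_within_Icc_nonneg_imp_le[of a b F F'] nonneg DERIV_subset[OF F]) auto
  have const: "F (min w 0) = F z" if "z \<in> layer" for z
  proof -
    have "F (max w 0) \<le> F (min w 0)"
      using ends w by (auto simp: orientation_def sgn_if min_def max_def split: if_splits)
    moreover have "F (min w 0) \<le> F z" "F z \<le> F (max w 0)"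
      using that layer_le by (auto intro!: le)
    ultimately show ?thesis by linarith
  qed
  have "((\<lambda>_. F (min w 0)) has_real_derivative F' x) (at x within layer)"
    by (rule has_real_derivative_transform[OF x const F[OF x]])
  then show ?thesis
    using layer_derivative_unique[OF x _ DERIV_const] by metis
qed

text \<open>The density of the quadratic form whose stationary points are the mode equations, in polarised
  form: arguments are the values and derivatives of two pairs \<open>(\<phi>, \<psi>)\<close> and \<open>(f, h)\<close>.\<close>

definition bil :: "real \<Rightarrow> real \<Rightarrow> real \<Rightarrow> real \<Rightarrow> real \<Rightarrow> real \<Rightarrow> real \<Rightarrow> real \<Rightarrow> real \<Rightarrow> real \<Rightarrow> real" where
  "bil lam x \<phi> \<psi> \<phi>' \<psi>' f h f' h' =
     lam * e x * ((\<phi>' - k * \<psi>) * (f' - k * h) + (\<psi>' - k * \<phi>) * (h' - k * f))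
     + bulk lam x * (k * \<phi> + \<psi>') * (k * f + h')
     + lam\<^sup>2 * \<rho> x * (\<phi> * f + \<psi> * h) - g * k * \<rho> x * (\<phi> * h + \<psi> * f)"

abbreviation "energy lam x \<phi> \<psi> \<phi>' \<psi>' \<equiv> bil lam x \<phi> \<psi> \<phi>' \<psi>' \<phi> \<psi> \<phi>' \<psi>'"

lemma stress_relations:
  assumes "0 < lam" "x \<in> layer"
  shows "tangential y x = lam * e x * (dphi lam x (y x) - k * psi y x)"
    "normal y x = (bulk lam x + lam * e x) * dpsi lam x (y x) + k * (bulk lam x - lam * e x) * phi y x"
proof -
  have 1: "lam * e x \<noteq> 0" "0 < lam * e x" using assms e_pos by (auto simp: less_imp_neq[symmetric])
  have 2: "bulk lam x + lam * e x \<noteq> 0" using bulk_pos[OF assms] 1(2) by linarith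
  show "tangential y x = lam * e x * (dphi lam x (y x) - k * psi y x)"
    using 1 by (simp add: dphi_def split_beta)
  show "normal y x = (bulk lam x + lam * e x) * dpsi lam x (y x) + k * (bulk lam x - lam * e x) * phi y x"
    using 2 by (simp add: dpsi_def split_beta)
qed

text \<open>The system is Hamiltonian for this density: the work of the tractions of a solution on any
  displacement \<open>(f, h)\<close> is an antiderivative of it. This replaces integration by parts.\<close>

lemma work_has_derivative:
  assumes "0 < lam" "flow lam y" "x \<in> layer"
    and f: "(f has_real_derivative f') (at x within layer)" and h: "(h has_real_derivative h') (at x within layer)"
  shows "((\<lambda>x. f x * tangential y x + h x * normal y x) has_real_derivative
    bil lam x (phi y x) (psi y x) (dphi lam x (y x)) (dpsi lam x (y x)) (f x) (h x) f' h') (at x within layer)"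
  by (rule derivative_eq_intros f h flow_components[OF assms(2,3)] refl)+
     (simp add: stress_relations[OF assms(1,3)] bil_def power2_eq_square algebra_simps)

text \<open>The form is symmetric, so the Wronskian of two solutions is constant, and it vanishes at the
  wall.\<close>

lemma traction_symmetric:
  assumes "0 < lam" "flow lam y" "flow lam z"
    and "phi y w = 0" "psi y w = 0" "phi z w = 0" "psi z w = 0"
  shows "phi z 0 * tangential y 0 + psi z 0 * normal y 0 = phi y 0 * tangential z 0 + psi y 0 * normal z 0"
proof -
  let ?W = "\<lambda>x. (phi z x * tangential y x + psi z x * normal y x) - (phi y x * tangential z x + psi y x * normal z x)"
  have W: "(?W has_real_derivative 0) (at x within layer)" if x: "x \<in> layer" for x
    using DERIV_diff[OF work_has_derivative[OF assms(1,2) x flow_components(1,2)[OF assms(3) x]]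
          work_has_derivative[OF assms(1,3) x flow_components(1,2)[OF assms(2) x]]]
    by (simp add: bil_def algebra_simps)
  have "((\<lambda>x. - ?W x) has_real_derivative 0) (at x within layer)" if x: "x \<in> layer" for x
    using DERIV_minus[OF W[OF x]] by simp
  then have "orientation * (- ?W w) \<le> orientation * (- ?W 0)"
    by (intro layer_mono[where F' = "\<lambda>_. 0"]) auto
  moreover have "orientation * ?W w \<le> orientation * ?W 0"
    using W by (intro layer_mono[where F' = "\<lambda>_. 0"]) auto
  ultimately show ?thesis
    using w assms(4-7) by (auto simp: orientation_def sgn_if split: if_splits)
qed

text \<open>The only indefinite term \<open>-2 g \<rho> k \<phi> \<psi>\<close> is completed to a square with the compression term; by
  hydrostatic balance the remainder is the exact derivative of \<open>g \<rho> \<psi>\<^sup>2\<close>. Inside a layer the fluid is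
  therefore stable, and the instability can only come from the interface value of \<open>\<psi>\<close>.\<close>

lemma energy_eq:
  assumes "x \<in> layer"
  shows "energy lam x \<phi> \<psi> \<phi>' \<psi>' =
    lam * e x * ((\<phi>' - k * \<psi>)\<^sup>2 + (\<psi>' - k * \<phi>)\<^sup>2) + (lam * d x + lam * e x / 3) * (k * \<phi> + \<psi>')\<^sup>2
    + Q x * \<rho> x * (k * \<phi> + \<psi>' - g * \<psi> / Q x)\<^sup>2 + lam\<^sup>2 * \<rho> x * (\<phi>\<^sup>2 + \<psi>\<^sup>2)
    + g * (- g * \<rho> x / Q x * \<psi>\<^sup>2 + \<rho> x * (2 * \<psi> * \<psi>'))"
proof -
  define u where "u = \<rho> x / Q x"
  have Q: "Q x \<noteq> 0" using Q_pos[OF assms] by simp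
  have u: "- g * \<rho> x / Q x = - g * u" by (simp add: u_def)
  have sq: "Q x * \<rho> x * (k * \<phi> + \<psi>' - g * \<psi> / Q x)\<^sup>2 =
    Q x * \<rho> x * (k * \<phi> + \<psi>')\<^sup>2 - 2 * g * \<rho> x * \<psi> * (k * \<phi> + \<psi>') + g\<^sup>2 * u * \<psi>\<^sup>2"
    using Q by (simp add: u_def power2_eq_square field_simps)
  show ?thesis
    unfolding u sq by (simp add: bil_def bulk_def power2_eq_square field_simps)
qed

lemma energy_lower_bound:
  assumes "0 < lam" "x \<in> layer"
  shows "lam\<^sup>2 * \<rho> x * (\<phi>\<^sup>2 + \<psi>\<^sup>2) + g * (- g * \<rho> x / Q x * \<psi>\<^sup>2 + \<rho> x * (2 * \<psi> * \<psi>')) \<le> energy lam x \<phi> \<psi> \<phi>' \<psi>'"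
proof -
  have "0 \<le> lam * e x * ((\<phi>' - k * \<psi>)\<^sup>2 + (\<psi>' - k * \<phi>)\<^sup>2)" "0 \<le> (lam * d x + lam * e x / 3) * (k * \<phi> + \<psi>')\<^sup>2"
    "0 \<le> Q x * \<rho> x * (k * \<phi> + \<psi>' - g * \<psi> / Q x)\<^sup>2"
    using assms e_pos[OF assms(2)] d_nonneg[OF assms(2)] \<rho>_pos[OF assms(2)] Q_pos[OF assms(2)] by auto
  then show ?thesis unfolding energy_eq[OF assms(2)] by linarith
qed

lemma weight_has_derivative:
  assumes "x \<in> layer" "(h has_real_derivative h') (at x within layer)"
  shows "((\<lambda>x. g * (\<rho> x * (h x)\<^sup>2)) has_real_derivative g * (- g * \<rho> x / Q x * (h x)\<^sup>2 + \<rho> x * (2 * h x * h')))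
    (at x within layer)"
  by (rule derivative_eq_intros hydrostatic[OF assms(1)] assms(2) refl)+ (simp add: algebra_simps)

text \<open>Subtracting \<open>g \<rho> \<psi>\<^sup>2\<close> from the work of the tractions leaves a monotone quantity that starts from
  zero at the wall.\<close>

lemma flow_energy:
  assumes lam: "0 < lam" and y: "flow lam y" and wall: "phi y w = 0" "psi y w = 0"
  defines "G \<equiv> \<lambda>x. phi y x * tangential y x + psi y x * normal y x - g * (\<rho> x * (psi y x)\<^sup>2)"
  shows "0 \<le> orientation * G 0"
    and "\<And>x. orientation * G 0 \<le> 0 \<Longrightarrow> x \<in> layer \<Longrightarrow> phi y x = 0 \<and> psi y x = 0"
proof -
  let ?G' = "\<lambda>x. energy lam x (phi y x) (psi y x) (dphi lam x (y x)) (dpsi lam x (y x)) -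
      g * (- g * \<rho> x / Q x * (psi y x)\<^sup>2 + \<rho> x * (2 * psi y x * dpsi lam x (y x)))"
  have G': "(G has_real_derivative ?G' x) (at x within layer)" if x: "x \<in> layer" for x
    unfolding G_def
    by (intro DERIV_diff work_has_derivative[OF lam y x] weight_has_derivative x flow_components[OF y x])
  have bound: "lam\<^sup>2 * \<rho> x * ((phi y x)\<^sup>2 + (psi y x)\<^sup>2) \<le> ?G' x" if x: "x \<in> layer" for x
    using energy_lower_bound[OF lam x, of "phi y x" "psi y x" "dpsi lam x (y x)" "dphi lam x (y x)"] by linarith
  have nonneg: "0 \<le> ?G' x" if x: "x \<in> layer" for x
    using bound[OF x] \<rho>_pos[OF x] by (smt (verit) mult_nonneg_nonneg zero_le_power2)
  have Gw: "G w = 0" using wall by (simp add: G_def)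
  show "0 \<le> orientation * G 0"
    using layer_mono[OF G' nonneg] Gw by simp
  fix x assume "orientation * G 0 \<le> 0" and x: "x \<in> layer"
  then have "?G' x = 0"
    using layer_derivative_zero[OF G' nonneg _ x] Gw by simp
  with bound[OF x] have "lam\<^sup>2 * \<rho> x * ((phi y x)\<^sup>2 + (psi y x)\<^sup>2) \<le> 0" by simp
  moreover have "0 < lam\<^sup>2 * \<rho> x" using lam \<rho>_pos[OF x] by simp
  ultimately have "(phi y x)\<^sup>2 + (psi y x)\<^sup>2 \<le> 0"
    by (smt (verit) mult_pos_pos)
  then show "phi y x = 0 \<and> psi y x = 0"
    by (smt (verit) power2_eq_square sum_power2_le_zero_iff zero_le_power2)
qed

text \<open>With zero displacement at the interface as well, the monotone quantity vanishes at both ends, and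
  the equality case leaves only the trivial solution.\<close>

lemma flow_dirichlet_unique:
  assumes lam: "0 < lam" and y: "flow lam y" and "phi y w = 0" "psi y w = 0" "phi y 0 = 0" "psi y 0 = 0"
  shows "y w = 0"
proof -
  have z: "phi y x = 0" "psi y x = 0" if "x \<in> layer" for x
    using flow_energy(2)[OF lam y assms(3,4) _ that] assms(5,6) by auto
  have w: "w \<in> layer" by (rule layer_ends)
  have "((\<lambda>_. 0) has_real_derivative dphi lam w (y w)) (at w within layer)"
    by (rule has_real_derivative_transform[OF w _ flow_components(1)[OF y w]]) (simp add: z)
  then have 1: "dphi lam w (y w) = 0"
    using layer_derivative_unique[OF w _ DERIV_const] by metis
  have "((\<lambda>_. 0) has_real_derivative dpsi lam w (y w)) (at w within layer)"
    by (rule has_real_derivative_transform[OF w _ flow_components(2)[OF y w]]) (simp add: z)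
  then have 2: "dpsi lam w (y w) = 0"
    using layer_derivative_unique[OF w _ DERIV_const] by metis
  show ?thesis
    using stress_relations[OF lam w, of y] 1 2 z[OF w] by (simp add: prod_eq_iff)
qed

text \<open>For large growth rates inertia dominates: \<open>\<lambda>\<^sup>2 \<rho> (\<phi>\<^sup>2 + \<psi>\<^sup>2)\<close> absorbs \<open>2 g \<rho> k \<phi> \<psi>\<close>.\<close>

lemma flow_traction_pos:
  assumes "0 < lam" "g * k < lam\<^sup>2" and y: "flow lam y" and wall: "phi y w = 0" "psi y w = 0"
    and nz: "phi y 0 \<noteq> 0 \<or> psi y 0 \<noteq> 0"
  shows "0 < orientation * (phi y 0 * tangential y 0 + psi y 0 * normal y 0)"
proof (rule ccontr)
  assume neg: "\<not> ?thesis"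
  let ?E = "\<lambda>x. energy lam x (phi y x) (psi y x) (dphi lam x (y x)) (dpsi lam x (y x))"
  have bound: "(lam\<^sup>2 - g * k) * \<rho> x * ((phi y x)\<^sup>2 + (psi y x)\<^sup>2) \<le> ?E x" if x: "x \<in> layer" for x
  proof -
    have "0 \<le> lam * e x * ((dphi lam x (y x) - k * psi y x)\<^sup>2 + (dpsi lam x (y x) - k * phi y x)\<^sup>2)"
      "0 \<le> bulk lam x * (k * phi y x + dpsi lam x (y x))\<^sup>2"
      "0 \<le> g * k * \<rho> x * (phi y x - psi y x)\<^sup>2"
      using assms(1) e_pos[OF x] bulk_pos[OF assms(1) x] g k \<rho>_pos[OF x] by auto
    then show ?thesis
      by (simp add: bil_def power2_eq_square algebra_simps)
  qed
  have "0 \<le> ?E x" if x: "x \<in> layer" for x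
    using bound[OF x] \<rho>_pos[OF x] assms(2) by (smt (verit) mult_nonneg_nonneg zero_le_power2)
  then have "?E 0 = 0"
    using neg wall by (intro layer_derivative_zero[OF work_has_derivative[OF assms(1) y _ flow_components(1,2)[OF y]]])
      (auto simp: layer_ends)
  with bound[OF layer_ends(2)] have "(lam\<^sup>2 - g * k) * \<rho> 0 * ((phi y 0)\<^sup>2 + (psi y 0)\<^sup>2) \<le> 0" by simp
  moreover have "0 < (lam\<^sup>2 - g * k) * \<rho> 0 * ((phi y 0)\<^sup>2 + (psi y 0)\<^sup>2)"
    using nz assms(2) \<rho>_pos[OF layer_ends(2)] by (auto simp: sum_power2_gt_zero_iff)
  ultimately show False by simp
qed


text \<open>The solution with given boundary values minimises the energy, so a test displacement bounds its
  traction from above. The test displacement makes the compression term of the energy vanish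
  identically, \<open>k \<phi> = -(\<rho> \<psi>)' / \<rho>\<close>; what remains is the exact derivative of \<open>g \<rho> \<psi>\<^sup>2\<close> and terms with a
  factor \<open>\<lambda>\<close>. To satisfy the boundary conditions, \<open>\<rho> \<psi>\<close> is a multiple of
  \<open>\<eta> = (1 - (x/w)\<^sup>2)\<^sup>2\<close>: this polynomial equals \<open>1\<close> at the interface, \<open>0\<close> at the wall, and its
  derivative vanishes at both.\<close>

lemma flow_traction_bound:
  obtains C where "\<And>lam y. 0 < lam \<Longrightarrow> lam \<le> 1 \<Longrightarrow> flow lam y \<Longrightarrow> phi y w = 0 \<Longrightarrow> psi y w = 0 \<Longrightarrow>
    phi y 0 = 0 \<Longrightarrow> psi y 0 = 1 \<Longrightarrow> orientation * normal y 0 \<le> orientation * (g * \<rho> 0) + lam * C"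
proof -
  define \<eta> \<eta>' \<eta>'' where "\<eta> x = (1 - (x / w)\<^sup>2)\<^sup>2" and "\<eta>' x = - 4 * x / w\<^sup>2 * (1 - (x / w)\<^sup>2)"
    and "\<eta>'' x = 12 * x\<^sup>2 / w ^ 4 - 4 / w\<^sup>2" for x
  have \<eta>: "(\<eta> has_real_derivative \<eta>' x) (at x within layer)" for x
    unfolding \<eta>_def \<eta>'_def using w
    by (auto intro!: derivative_eq_intros simp: field_simps power2_eq_square)
  have \<eta>': "(\<eta>' has_real_derivative \<eta>'' x) (at x within layer)" for x
    unfolding \<eta>'_def \<eta>''_def using w
    by (auto intro!: derivative_eq_intros simp: field_simps power2_eq_square power4_eq_xxxx)
  define f h f' h' where "f x = - \<rho> 0 * \<eta>' x / (k * \<rho> x)" and "h x = \<rho> 0 * \<eta> x / \<rho> x"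
    and "f' x = - \<rho> 0 / k * (\<eta>'' x + \<eta>' x * g / Q x) / \<rho> x"
    and "h' x = \<rho> 0 * (\<eta>' x + \<eta> x * g / Q x) / \<rho> x" for x
  have f: "(f has_real_derivative f' x) (at x within layer)" if x: "x \<in> layer" for x
    unfolding f_def f'_def using k \<rho>_pos[OF x] Q_pos[OF x]
    by (auto intro!: derivative_eq_intros \<eta>' hydrostatic x simp: field_simps)
  have h: "(h has_real_derivative h' x) (at x within layer)" if x: "x \<in> layer" for x
    unfolding h_def h'_def using k \<rho>_pos[OF x] Q_pos[OF x]
    by (auto intro!: derivative_eq_intros \<eta> hydrostatic x simp: field_simps)
  have balance: "k * f x + h' x - g * h x / Q x = 0" if x: "x \<in> layer" for x
    unfolding f_def h_def h'_def using k \<rho>_pos[OF x] Q_pos[OF x] by (simp add: field_simps)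
  define R where "R x = e x * ((f' x - k * h x)\<^sup>2 + (h' x - k * f x)\<^sup>2) + (d x + e x / 3) * (k * f x + h' x)\<^sup>2
     + \<rho> x * ((f x)\<^sup>2 + (h x)\<^sup>2)" for x
  have "\<forall>x\<in>layer. \<rho> x \<noteq> 0" "\<forall>x\<in>layer. Q x \<noteq> 0"
    using \<rho>_pos Q_pos by (metis less_irrefl)+
  then have "continuous_on layer R"
    unfolding R_def f_def h_def f'_def h'_def \<eta>_def \<eta>'_def \<eta>''_def using k w
    by (intro continuous_intros \<rho>_cont Q_cont e_cont d_cont) auto
  then have "bdd_above (R ` layer)"
    by (intro bounded_imp_bdd_above compact_imp_bounded compact_continuous_image) auto
  then obtain C where C: "\<And>x. x \<in> layer \<Longrightarrow> R x \<le> C"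
    unfolding bdd_above_def by (metis imageI)
  show ?thesis
  proof (rule that[of "C * \<bar>w\<bar>"])
    fix lam y assume lam: "0 < lam" "lam \<le> 1" and y: "flow lam y" and wall: "phi y w = 0" "psi y w = 0"
      and trace: "phi y 0 = 0" "psi y 0 = 1"
    let ?f = "\<lambda>x. f x - phi y x" and ?h = "\<lambda>x. h x - psi y x"
    \<comment> \<open>The test displacement is the solution plus a remainder that vanishes at both ends. \<open>M\<close> is an
      antiderivative of its energy, except that the part quadratic in the remainder is replaced by
      an exact derivative from below.\<close>
    define M where "M x = (phi y x * tangential y x + psi y x * normal y x)
      + 2 * (?f x * tangential y x + ?h x * normal y x) + g * (\<rho> x * (?h x)\<^sup>2)" for x
    define M' where "M' x = energy lam x (phi y x) (psi y x) (dphi lam x (y x)) (dpsi lam x (y x))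
      + 2 * bil lam x (phi y x) (psi y x) (dphi lam x (y x)) (dpsi lam x (y x)) (?f x) (?h x)
           (f' x - dphi lam x (y x)) (h' x - dpsi lam x (y x))
      + g * (- g * \<rho> x / Q x * (?h x)\<^sup>2 + \<rho> x * (2 * ?h x * (h' x - dpsi lam x (y x))))" for x
    have M: "(M has_real_derivative M' x) (at x within layer)" if x: "x \<in> layer" for x
      unfolding M_def M'_def
      by (intro DERIV_add DERIV_cmult work_has_derivative[OF lam(1) y x] weight_has_derivative[OF x]
          DERIV_diff f[OF x] h[OF x] flow_components[OF y x])
    define W' where "W' x = g * (- g * \<rho> x / Q x * (h x)\<^sup>2 + \<rho> x * (2 * h x * h' x))" for x
    have bound: "M' x \<le> W' x + lam * C" if x: "x \<in> layer" for x
    proof -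
      have "M' x \<le> energy lam x (phi y x) (psi y x) (dphi lam x (y x)) (dpsi lam x (y x))
        + 2 * bil lam x (phi y x) (psi y x) (dphi lam x (y x)) (dpsi lam x (y x)) (?f x) (?h x)
           (f' x - dphi lam x (y x)) (h' x - dpsi lam x (y x))
        + energy lam x (?f x) (?h x) (f' x - dphi lam x (y x)) (h' x - dpsi lam x (y x))"
      proof -
        have "0 \<le> lam\<^sup>2 * \<rho> x * ((?f x)\<^sup>2 + (?h x)\<^sup>2)" using \<rho>_pos[OF x] by simp
        then show ?thesis
          using energy_lower_bound[OF lam(1) x, of "?f x" "?h x" "h' x - dpsi lam x (y x)" "f' x - dphi lam x (y x)"]
          unfolding M'_def by linarith
      qed
      also have "\<dots> = energy lam x (f x) (h x) (f' x) (h' x)"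
        by (simp add: bil_def algebra_simps)
      also have "\<dots> = lam * (e x * ((f' x - k * h x)\<^sup>2 + (h' x - k * f x)\<^sup>2) + (d x + e x / 3) * (k * f x + h' x)\<^sup>2)
         + lam\<^sup>2 * (\<rho> x * ((f x)\<^sup>2 + (h x)\<^sup>2)) + W' x"
        unfolding energy_eq[OF x] balance[OF x] W'_def by (simp add: algebra_simps)
      also have "\<dots> \<le> lam * R x + W' x"
      proof -
        have "lam\<^sup>2 * (\<rho> x * ((f x)\<^sup>2 + (h x)\<^sup>2)) \<le> lam * (\<rho> x * ((f x)\<^sup>2 + (h x)\<^sup>2))"
          using lam \<rho>_pos[OF x] by (intro mult_right_mono) (auto simp: power2_eq_square mult_left_le)
        then show ?thesis by (simp add: R_def distrib_left)
      qed
      also have "\<dots> \<le> lam * C + W' x"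
        using C[OF x] lam by simp
      finally show ?thesis by simp
    qed
    define D where "D x = g * (\<rho> x * (h x)\<^sup>2) + lam * C * x - M x" for x
    have "(D has_real_derivative W' x + lam * C - M' x) (at x within layer)" if x: "x \<in> layer" for x
      unfolding D_def W'_def
      by (rule derivative_eq_intros M[OF x] weight_has_derivative[OF x h[OF x]] refl)+ simp
    moreover have "0 \<le> W' x + lam * C - M' x" if "x \<in> layer" for x
      using bound[OF that] by simp
    ultimately have "orientation * D w \<le> orientation * D 0"
      by (rule layer_mono)
    moreover have "f w = 0" "h w = 0" "f 0 = 0" "h 0 = 1"
      using w \<rho>_pos[OF layer_ends(2)] by (auto simp: f_def h_def \<eta>_def \<eta>'_def)
    ultimately have "orientation * (lam * C * w) \<le> orientation * (g * \<rho> 0 - normal y 0)"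
      using wall trace by (simp add: D_def M_def)
    moreover have "orientation * (lam * C * w) = - (lam * (C * \<bar>w\<bar>))"
      by (simp add: orientation_def abs_sgn mult_ac)
    ultimately show "orientation * normal y 0 \<le> orientation * (g * \<rho> 0) + lam * (C * \<bar>w\<bar>)"
      by (simp add: right_diff_distrib)
  qed
qed

lemma flow_from_wall:
  assumes "0 < lo" "lo \<le> hi"
  obtains Y where "continuous_on {lo..hi} (\<lambda>lam. Y lam 0)"
    "\<And>lam. lam \<in> {lo..hi} \<Longrightarrow> flow lam (Y lam)" "\<And>lam. lam \<in> {lo..hi} \<Longrightarrow> Y lam w = y0"
proof -
  have F: "continuous_on (({min w 0..max w 0} \<times> {lo..hi}) \<times> UNIV) (\<lambda>(p, y). mode_field (snd p) (fst p) y)"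
    by (rule continuous_on_mode_field[OF assms(1)])
  have lin: "linear (mode_field (snd p) (fst p))" for p by (rule linear_mode_field)
  have "\<exists>Y. continuous_on (layer \<times> {lo..hi}) Y \<and> (\<forall>s\<in>{lo..hi}. Y (w, s) = y0) \<and>
     (\<forall>x\<in>layer. \<forall>s\<in>{lo..hi}.
       ((\<lambda>x. Y (x, s)) has_vector_derivative mode_field s x (Y (x, s))) (at x within layer))"
  proof (cases "w < 0")
    case True
    show ?thesis
      by (rule linear_ode_parametric_left[OF less_imp_le[OF layer_le] assms(2) F lin, of y0])
         (use True in \<open>auto simp: min_def max_def\<close>)
  next
    case False
    show ?thesis
      by (rule linear_ode_parametric_right[OF less_imp_le[OF layer_le] assms(2) F lin, of y0])
         (use False w in \<open>auto simp: min_def max_def split: if_splits\<close>)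
  qed
  then obtain Y where Y: "continuous_on (layer \<times> {lo..hi}) Y" "\<And>s. s \<in> {lo..hi} \<Longrightarrow> Y (w, s) = y0"
    "\<And>x s. x \<in> layer \<Longrightarrow> s \<in> {lo..hi} \<Longrightarrow>
       ((\<lambda>x. Y (x, s)) has_vector_derivative mode_field s x (Y (x, s))) (at x within layer)"
    by blast
  show ?thesis
  proof (rule that[of "\<lambda>lam x. Y (x, lam)"])
    show "continuous_on {lo..hi} (\<lambda>lam. Y (0, lam))"
      using layer_ends by (intro continuous_on_compose2[OF Y(1)]) (auto intro!: continuous_intros)
  qed (use Y in \<open>auto simp: flow_def\<close>)
qed

text \<open>Two solutions from the wall, recombined to have the interface values \<open>(1, 0)\<close> and \<open>(0, 1)\<close>. Uniqueness
  for the Dirichlet problem makes the recombination possible, and Cramer's rule shows that it is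
  continuous in the growth rate.\<close>

lemma traction_matrix:
  assumes "0 < lo" "lo \<le> hi"
  obtains U V where
    "\<And>lam. lam \<in> {lo..hi} \<Longrightarrow> flow lam (U lam) \<and> phi (U lam) w = 0 \<and> psi (U lam) w = 0 \<and>
      phi (U lam) 0 = 1 \<and> psi (U lam) 0 = 0"
    "\<And>lam. lam \<in> {lo..hi} \<Longrightarrow> flow lam (V lam) \<and> phi (V lam) w = 0 \<and> psi (V lam) w = 0 \<and>
      phi (V lam) 0 = 0 \<and> psi (V lam) 0 = 1"
    "continuous_on {lo..hi} (\<lambda>lam. U lam 0)" "continuous_on {lo..hi} (\<lambda>lam. V lam 0)"
proof -
  obtain Y where Y: "continuous_on {lo..hi} (\<lambda>lam. Y lam 0)"
    "\<And>lam. lam \<in> {lo..hi} \<Longrightarrow> flow lam (Y lam)" "\<And>lam. lam \<in> {lo..hi} \<Longrightarrow> Y lam w = (0, 0, 1, 0)"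
    using flow_from_wall[OF assms, of "(0, 0, 1, 0)"] by metis
  obtain Z where Z: "continuous_on {lo..hi} (\<lambda>lam. Z lam 0)"
    "\<And>lam. lam \<in> {lo..hi} \<Longrightarrow> flow lam (Z lam)" "\<And>lam. lam \<in> {lo..hi} \<Longrightarrow> Z lam w = (0, 0, 0, 1)"
    using flow_from_wall[OF assms, of "(0, 0, 0, 1)"] by metis
  define \<Delta> where "\<Delta> lam = phi (Y lam) 0 * psi (Z lam) 0 - phi (Z lam) 0 * psi (Y lam) 0" for lam
  have trivial: "\<alpha> = 0 \<and> \<beta> = 0" if lam: "lam \<in> {lo..hi}"
    and "\<alpha> * phi (Y lam) 0 + \<beta> * phi (Z lam) 0 = 0" "\<alpha> * psi (Y lam) 0 + \<beta> * psi (Z lam) 0 = 0" for lam \<alpha> \<beta>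
  proof -
    have "(\<lambda>x. \<alpha> *\<^sub>R Y lam x + \<beta> *\<^sub>R Z lam x) w = 0"
      using that assms Y(3)[OF lam] Z(3)[OF lam]
      by (intro flow_dirichlet_unique[of lam] flow_lincomb Y(2) Z(2)) auto
    then show ?thesis using Y(3)[OF lam] Z(3)[OF lam] by (simp add: prod_eq_iff)
  qed
  have \<Delta>: "\<Delta> lam \<noteq> 0" if lam: "lam \<in> {lo..hi}" for lam
  proof
    assume 0: "\<Delta> lam = 0"
    have "psi (Z lam) 0 = 0 \<and> psi (Y lam) 0 = 0"
      using trivial[OF lam, of "psi (Z lam) 0" "- psi (Y lam) 0"] 0 by (simp add: \<Delta>_def algebra_simps)
    moreover from this have "phi (Z lam) 0 = 0"
      using trivial[OF lam, of "phi (Z lam) 0" "- phi (Y lam) 0"] by simp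
    ultimately show False
      using trivial[OF lam, of 0 1] by simp
  qed
  define U where "U lam x = (psi (Z lam) 0 / \<Delta> lam) *\<^sub>R Y lam x + (- psi (Y lam) 0 / \<Delta> lam) *\<^sub>R Z lam x" for lam x
  define V where "V lam x = (- phi (Z lam) 0 / \<Delta> lam) *\<^sub>R Y lam x + (phi (Y lam) 0 / \<Delta> lam) *\<^sub>R Z lam x" for lam x
  have \<Delta>c: "continuous_on {lo..hi} \<Delta>"
    unfolding \<Delta>_def by (intro continuous_intros Y(1) Z(1))
  show ?thesis
  proof (rule that[of U V])
    show "continuous_on {lo..hi} (\<lambda>lam. U lam 0)" "continuous_on {lo..hi} (\<lambda>lam. V lam 0)"
      unfolding U_def V_def using \<Delta> by (auto intro!: continuous_intros Y(1) Z(1) \<Delta>c)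
    fix lam assume lam: "lam \<in> {lo..hi}"
    have "flow lam (U lam)" "flow lam (V lam)"
      unfolding U_def V_def by (intro flow_lincomb Y(2) Z(2) lam)+
    moreover have "phi (U lam) 0 = 1" "psi (V lam) 0 = 1"
      using \<Delta>[OF lam] by (simp_all add: U_def V_def field_simps) (simp_all add: \<Delta>_def algebra_simps)
    moreover have "psi (U lam) 0 = 0" "phi (V lam) 0 = 0"
      by (simp_all add: U_def V_def)
    moreover have "phi (U lam) w = 0" "psi (U lam) w = 0" "phi (V lam) w = 0" "psi (V lam) w = 0"
      using Y(3)[OF lam] Z(3)[OF lam] by (simp_all add: U_def V_def)
    ultimately show "flow lam (U lam) \<and> phi (U lam) w = 0 \<and> psi (U lam) w = 0 \<and>
      phi (U lam) 0 = 1 \<and> psi (U lam) 0 = 0"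
      "flow lam (V lam) \<and> phi (V lam) w = 0 \<and> psi (V lam) w = 0 \<and>
      phi (V lam) 0 = 0 \<and> psi (V lam) 0 = 1" by auto
  qed
qed

end

section \<open>From the first-order system to the mode equations\<close>

context fluid_layer
begin

abbreviation inner_layer :: "real set" where "inner_layer \<equiv> {min w 0<..<max w 0}"

lemma flow_components_interior:
  assumes "flow lam y" "x \<in> inner_layer"
  shows "(phi y has_real_derivative dphi lam x (y x)) (at x)"
    "(psi y has_real_derivative dpsi lam x (y x)) (at x)"
    "(tangential y has_real_derivative
      (lam\<^sup>2 * \<rho> x + lam * e x * k\<^sup>2 + k\<^sup>2 * bulk lam x) * phi y x
        + k * (bulk lam x - lam * e x) * dpsi lam x (y x) - g * k * \<rho> x * psi y x) (at x)"
    "(normal y has_real_derivative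
      (lam\<^sup>2 * \<rho> x + lam * e x * k\<^sup>2) * psi y x - g * k * \<rho> x * phi y x - k * lam * e x * dphi lam x (y x))
      (at x)"
proof -
  have at: "at x within layer = at x"
    using assms(2) by (intro at_within_Icc_at) auto
  have x: "x \<in> layer" using assms(2) by auto
  show "(phi y has_real_derivative dphi lam x (y x)) (at x)"
    "(psi y has_real_derivative dpsi lam x (y x)) (at x)"
    "(tangential y has_real_derivative
      (lam\<^sup>2 * \<rho> x + lam * e x * k\<^sup>2 + k\<^sup>2 * bulk lam x) * phi y x
        + k * (bulk lam x - lam * e x) * dpsi lam x (y x) - g * k * \<rho> x * psi y x) (at x)"
    "(normal y has_real_derivative
      (lam\<^sup>2 * \<rho> x + lam * e x * k\<^sup>2) * psi y x - g * k * \<rho> x * phi y x - k * lam * e x * dphi lam x (y x))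
      (at x)"
    by (rule flow_components[OF assms(1) x, unfolded at])+
qed

text \<open>Bootstrapping along the first-order system.\<close>

lemma flow_times_differentiable:
  assumes lam: "0 < lam" and y: "flow lam y"
    and smooth: "\<And>n. times_differentiable_on n inner_layer \<rho>" "\<And>n. times_differentiable_on n inner_layer Q"
      "\<And>n. times_differentiable_on n inner_layer e" "\<And>n. times_differentiable_on n inner_layer d"
  shows "times_differentiable_on n inner_layer (phi y) \<and> times_differentiable_on n inner_layer (psi y) \<and>
    times_differentiable_on n inner_layer (tangential y) \<and> times_differentiable_on n inner_layer (normal y)"
proof (induction n)
  case (Suc n)
  have mem: "x \<in> layer" if "x \<in> inner_layer" for x using that by auto
  note D = flow_components_interior[OF y]
  have nz: "lam * e x \<noteq> 0" "bulk lam x + lam * e x \<noteq> 0" if "x \<in> inner_layer" for x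
    using mult_pos_pos[OF lam e_pos[OF mem[OF that]]] bulk_pos[OF lam mem[OF that]] by auto
  note td = times_differentiable_intros
  have bulk: "times_differentiable_on n inner_layer (bulk lam)"
    unfolding bulk_def[abs_def] by (intro td smooth) auto
  have dphi: "times_differentiable_on n inner_layer (\<lambda>x. dphi lam x (y x))"
    unfolding dphi_def split_beta using Suc nz by (intro td smooth) auto
  have dpsi: "times_differentiable_on n inner_layer (\<lambda>x. dpsi lam x (y x))"
    unfolding dpsi_def split_beta using Suc nz by (intro td smooth bulk) auto
  have tang: "times_differentiable_on n inner_layer (\<lambda>x. (lam\<^sup>2 * \<rho> x + lam * e x * k\<^sup>2 + k\<^sup>2 * bulk lam x) * phi y x
        + k * (bulk lam x - lam * e x) * dpsi lam x (y x) - g * k * \<rho> x * psi y x)"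
    using Suc by (intro td smooth bulk dpsi) auto
  have norm: "times_differentiable_on n inner_layer (\<lambda>x. (lam\<^sup>2 * \<rho> x + lam * e x * k\<^sup>2) * psi y x
      - g * k * \<rho> x * phi y x - k * lam * e x * dphi lam x (y x))"
    using Suc by (intro td smooth dphi) auto
  show ?case
    by (intro conjI times_differentiable_on_SucI[OF D(1) dphi] times_differentiable_on_SucI[OF D(2) dpsi]
        times_differentiable_on_SucI[OF D(3) tang] times_differentiable_on_SucI[OF D(4) norm])
qed simp

text \<open>A planar solution, turned into the direction of the wave vector, agrees with the given profiles
  and coefficients inside the layer. At the ends nothing is said: there the profiles of the two
  layers have to be glued.\<close>

definition represents ::
  "real \<Rightarrow> (real \<Rightarrow> mode_state) \<Rightarrow> real^2 \<Rightarrow> (real \<Rightarrow> real) \<Rightarrow> (real \<Rightarrow> real) \<Rightarrow> (real \<Rightarrow> real) \<Rightarrow> (real \<Rightarrow> real) \<Rightarrow>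
    (real \<Rightarrow> real) \<Rightarrow> (real \<Rightarrow> real) \<Rightarrow> (real \<Rightarrow> real) \<Rightarrow> bool" where
  "represents lam y \<xi> \<rho>0 dP0 \<epsilon>0 \<delta>0 \<phi> \<theta> \<psi> \<longleftrightarrow> (\<forall>x\<in>inner_layer. \<rho>0 x = \<rho> x \<and> dP0 x = Q x \<and> \<epsilon>0 x = e x \<and> \<delta>0 x = d x \<and>
     \<phi> x = \<xi>$1 / k * phi y x \<and> \<theta> x = \<xi>$2 / k * phi y x \<and> \<psi> x = psi y x)"

lemma represents_derivs:
  assumes y: "flow lam y" and R: "represents lam y \<xi> \<rho>0 dP0 \<epsilon>0 \<delta>0 \<phi> \<theta> \<psi>" and x: "x \<in> inner_layer"
  shows "(\<phi> has_real_derivative \<xi>$1 / k * dphi lam x (y x)) (at x)"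
    "(\<theta> has_real_derivative \<xi>$2 / k * dphi lam x (y x)) (at x)"
    "(\<psi> has_real_derivative dpsi lam x (y x)) (at x)"
proof -
  note D = flow_components_interior[OF y x]
  have op: "open inner_layer" by simp
  show "(\<phi> has_real_derivative \<xi>$1 / k * dphi lam x (y x)) (at x)"
    by (rule has_field_derivative_transform_within_open[OF DERIV_cmult[OF D(1)] op x])
       (use R in \<open>auto simp: represents_def\<close>)
  show "(\<theta> has_real_derivative \<xi>$2 / k * dphi lam x (y x)) (at x)"
    by (rule has_field_derivative_transform_within_open[OF DERIV_cmult[OF D(1)] op x])
       (use R in \<open>auto simp: represents_def\<close>)
  show "(\<psi> has_real_derivative dpsi lam x (y x)) (at x)"
    by (rule has_field_derivative_transform_within_open[OF D(2) op x])
       (use R in \<open>auto simp: represents_def\<close>)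
qed

lemma direction_sq:
  assumes "norm (\<xi> :: real^2) = k"
  shows "\<xi>$1 * \<xi>$1 + \<xi>$2 * \<xi>$2 = k * k"
  using assms by (auto simp: norm_eq_sqrt_inner inner_vec_def sum_2)

text \<open>The stresses in the jump conditions, in terms of functions that are continuous up to the ends of
  the layer. Both components of \<open>\<xi>\<close> combine by \<open>\<xi>\<^sub>1\<^sup>2 + \<xi>\<^sub>2\<^sup>2 = k\<^sup>2\<close>.\<close>

lemma represents_traction:
  assumes lam: "0 < lam" and y: "flow lam y" and R: "represents lam y \<xi> \<rho>0 dP0 \<epsilon>0 \<delta>0 \<phi> \<theta> \<psi>"
    and \<xi>: "norm \<xi> = k" and x: "x \<in> inner_layer"
  shows "lam * \<epsilon>0 x * (deriv \<phi> x - \<xi>$1 * \<psi> x) = \<xi>$1 / k * tangential y x"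
    "lam * \<epsilon>0 x * (deriv \<theta> x - \<xi>$2 * \<psi> x) = \<xi>$2 / k * tangential y x"
    "(lam * \<delta>0 x + lam * \<epsilon>0 x / 3 + dP0 x * \<rho>0 x) * (deriv \<psi> x + \<xi>$1 * \<phi> x + \<xi>$2 * \<theta> x)
      = bulk lam x * (dpsi lam x (y x) + k * phi y x)"
    "lam * \<epsilon>0 x * (deriv \<psi> x - \<xi>$1 * \<phi> x - \<xi>$2 * \<theta> x) = lam * e x * (dpsi lam x (y x) - k * phi y x)"
    "\<xi>$1 * \<phi> x + \<xi>$2 * \<theta> x = k * phi y x"
proof -
  have xl: "x \<in> layer" using x by auto
  note D = represents_derivs[OF y R x, THEN DERIV_imp_deriv]
  note S = stress_relations[OF lam xl, of y]
  have eqs: "\<rho>0 x = \<rho> x" "dP0 x = Q x" "\<epsilon>0 x = e x" "\<delta>0 x = d x"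
     "\<phi> x = \<xi>$1 / k * phi y x" "\<theta> x = \<xi>$2 / k * phi y x" "\<psi> x = psi y x"
    using R x by (auto simp: represents_def)
  show 5: "\<xi>$1 * \<phi> x + \<xi>$2 * \<theta> x = k * phi y x"
  proof -
    have "\<xi>$1 * \<phi> x + \<xi>$2 * \<theta> x = (\<xi>$1 * \<xi>$1 + \<xi>$2 * \<xi>$2) / k * phi y x"
      by (simp add: eqs add_divide_distrib distrib_right)
    then show ?thesis using k by (simp add: direction_sq[OF \<xi>])
  qed
  show "lam * \<epsilon>0 x * (deriv \<phi> x - \<xi>$1 * \<psi> x) = \<xi>$1 / k * tangential y x"
    "lam * \<epsilon>0 x * (deriv \<theta> x - \<xi>$2 * \<psi> x) = \<xi>$2 / k * tangential y x"
    unfolding S D eqs using k by (simp_all add: field_simps)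
  show "(lam * \<delta>0 x + lam * \<epsilon>0 x / 3 + dP0 x * \<rho>0 x) * (deriv \<psi> x + \<xi>$1 * \<phi> x + \<xi>$2 * \<theta> x)
      = bulk lam x * (dpsi lam x (y x) + k * phi y x)"
    using 5 by (simp add: D eqs(1-4) bulk_def add.assoc)
  show "lam * \<epsilon>0 x * (deriv \<psi> x - \<xi>$1 * \<phi> x - \<xi>$2 * \<theta> x) = lam * e x * (dpsi lam x (y x) - k * phi y x)"
    using 5 by (simp add: D eqs(1-4) diff_diff_eq)
qed

text \<open>The derivative of \<open>\<lambda>\<epsilon> \<phi>'\<close> is found from \<open>\<lambda>\<epsilon> \<phi>' = p + k \<lambda>\<epsilon> \<psi>\<close>, and that of \<open>(A + \<lambda>\<epsilon>) \<psi>'\<close> from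
  \<open>(A + \<lambda>\<epsilon>) \<psi>' = q - k (A - \<lambda>\<epsilon>) \<phi>\<close>; here the derivatives of the viscosities re-enter.\<close>

lemma represents_mode_odes:
  assumes lam: "0 < lam" and y: "flow lam y" and R: "represents lam y \<xi> \<rho>0 dP0 \<epsilon>0 \<delta>0 \<phi> \<theta> \<psi>"
    and \<xi>: "norm \<xi> = k" and x: "x \<in> inner_layer"
    and smooth: "\<And>n. times_differentiable_on n inner_layer Q"
      "\<And>n. times_differentiable_on n inner_layer e" "\<And>n. times_differentiable_on n inner_layer d"
  shows "mode_odes g \<rho>0 dP0 \<epsilon>0 \<delta>0 lam \<xi> \<phi> \<theta> \<psi> x"
proof -
  have op: "open inner_layer" by simp
  have xl: "x \<in> layer" using x by auto
  have at: "at x within layer = at x" using x by (intro at_within_Icc_at) auto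
  note D = flow_components_interior[OF y x]
  note S = stress_relations[OF lam]
  have eqs: "\<rho>0 t = \<rho> t" "dP0 t = Q t" "\<epsilon>0 t = e t" "\<delta>0 t = d t"
     "\<phi> t = \<xi>$1 / k * phi y t" "\<theta> t = \<xi>$2 / k * phi y t" "\<psi> t = psi y t" if "t \<in> inner_layer" for t
    using R that by (auto simp: represents_def)
  obtain Q' where Q': "(Q has_real_derivative Q') (at x)"
    using smooth(1)[of 1] x unfolding One_nat_def times_differentiable_on.simps by blast
  obtain e' where e': "(e has_real_derivative e') (at x)"
    using smooth(2)[of 1] x unfolding One_nat_def times_differentiable_on.simps by blast
  obtain d' where d': "(d has_real_derivative d') (at x)"
    using smooth(3)[of 1] x unfolding One_nat_def times_differentiable_on.simps by blast
  have "(bulk lam has_real_derivative lam * d' + lam * e' / 3 + (Q' * \<rho> x + - g * \<rho> x / Q x * Q x)) (at x)"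
    unfolding bulk_def[abs_def]
    by (intro DERIV_add DERIV_cmult DERIV_cdivide DERIV_mult Q' e' d' hydrostatic[OF xl, unfolded at])
  then obtain A' where A': "(bulk lam has_real_derivative A') (at x)" ..
  have e0: "deriv \<epsilon>0 x = e'"
    by (intro DERIV_imp_deriv has_field_derivative_transform_within_open[OF e' op x]) (simp add: eqs)
  let ?p' = "(lam\<^sup>2 * \<rho> x + lam * e x * k\<^sup>2 + k\<^sup>2 * bulk lam x) * phi y x
        + k * (bulk lam x - lam * e x) * dpsi lam x (y x) - g * k * \<rho> x * psi y x"
  have viscous: "((\<lambda>t. tangential y t + k * (lam * (e t * psi y t))) has_real_derivative
      ?p' + k * (lam * (e' * psi y x + e x * dpsi lam x (y x)))) (at x)"
    by (rule derivative_eq_intros D e' refl)+ (simp add: algebra_simps)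
  have flux: "c * (tangential y t + k * (lam * (e t * psi y t))) = lam * e t * (c * dphi lam t (y t))"
    if "t \<in> inner_layer" for c t
  proof -
    have "t \<in> layer" using that by auto
    then show ?thesis by (simp add: S(1) algebra_simps)
  qed
  have d1: "deriv (\<lambda>t. lam * \<epsilon>0 t * deriv \<phi> t) x =
      \<xi>$1 / k * (?p' + k * (lam * (e' * psi y x + e x * dpsi lam x (y x))))"
    by (intro DERIV_imp_deriv has_field_derivative_transform_within_open[OF DERIV_cmult[OF viscous] op x])
       (simp only: flux DERIV_imp_deriv[OF represents_derivs(1)[OF y R]] eqs(3))
  have d2: "deriv (\<lambda>t. lam * \<epsilon>0 t * deriv \<theta> t) x =
      \<xi>$2 / k * (?p' + k * (lam * (e' * psi y x + e x * dpsi lam x (y x))))"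
    by (intro DERIV_imp_deriv has_field_derivative_transform_within_open[OF DERIV_cmult[OF viscous] op x])
       (simp only: flux DERIV_imp_deriv[OF represents_derivs(2)[OF y R]] eqs(3))
  have "((\<lambda>t. normal y t - k * ((bulk lam t - lam * e t) * phi y t)) has_real_derivative
     ((lam\<^sup>2 * \<rho> x + lam * e x * k\<^sup>2) * psi y x - g * k * \<rho> x * phi y x - k * lam * e x * dphi lam x (y x))
      - k * ((A' - lam * e') * phi y x + (bulk lam x - lam * e x) * dphi lam x (y x))) (at x)"
    by (rule derivative_eq_intros D e' A' refl)+ (simp add: algebra_simps)
  then have d3: "deriv (\<lambda>t. (4 * lam * \<epsilon>0 t / 3 + lam * \<delta>0 t + dP0 t * \<rho>0 t) * deriv \<psi> t) x =
     ((lam\<^sup>2 * \<rho> x + lam * e x * k\<^sup>2) * psi y x - g * k * \<rho> x * phi y x - k * lam * e x * dphi lam x (y x))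
      - k * ((A' - lam * e') * phi y x + (bulk lam x - lam * e x) * dphi lam x (y x))"
  proof (intro DERIV_imp_deriv, elim has_field_derivative_transform_within_open[OF _ op x])
    fix t assume t: "t \<in> inner_layer"
    then have "t \<in> layer" by auto
    then show "normal y t - k * ((bulk lam t - lam * e t) * phi y t) =
        (4 * lam * \<epsilon>0 t / 3 + lam * \<delta>0 t + dP0 t * \<rho>0 t) * deriv \<psi> t"
      by (simp add: S(2) DERIV_imp_deriv[OF represents_derivs(3)[OF y R t]] eqs[OF t] bulk_def field_simps)
  qed
  have "((\<lambda>t. k * (bulk lam t * phi y t)) has_real_derivative k * (A' * phi y x + bulk lam x * dphi lam x (y x))) (at x)"
    by (rule derivative_eq_intros D A' refl)+ (simp add: algebra_simps)
  then have d4: "deriv (\<lambda>t. (lam * \<delta>0 t + lam * \<epsilon>0 t / 3 + dP0 t * \<rho>0 t) * (\<xi>$1 * \<phi> t + \<xi>$2 * \<theta> t)) x =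
      k * (A' * phi y x + bulk lam x * dphi lam x (y x))"
  proof (intro DERIV_imp_deriv, elim has_field_derivative_transform_within_open[OF _ op x])
    fix t assume t: "t \<in> inner_layer"
    then show "k * (bulk lam t * phi y t) =
        (lam * \<delta>0 t + lam * \<epsilon>0 t / 3 + dP0 t * \<rho>0 t) * (\<xi>$1 * \<phi> t + \<xi>$2 * \<theta> t)"
      unfolding represents_traction(5)[OF lam y R \<xi> t] by (simp add: eqs bulk_def)
  qed
  have A: "lam * \<delta>0 x + lam * \<epsilon>0 x / 3 + dP0 x * \<rho>0 x = bulk lam x"
    by (simp add: eqs[OF x] bulk_def)
  have S1: "\<xi>$1 * (\<xi>$1 * \<phi> x + \<xi>$2 * \<theta> x) = \<xi>$1 * (k * phi y x)" "\<xi>$2 * (\<xi>$1 * \<phi> x + \<xi>$2 * \<theta> x) = \<xi>$2 * (k * phi y x)"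
    using represents_traction(5)[OF lam y R \<xi> x] by simp_all
  have o1: "(\<xi>$1)\<^sup>2 * B * \<phi> x + \<xi>$1 * \<xi>$2 * B * \<theta> x = B * (\<xi>$1 * (k * phi y x))" for B
    unfolding S1[symmetric] by (simp add: power2_eq_square algebra_simps)
  have o2: "(\<xi>$2)\<^sup>2 * B * \<theta> x + \<xi>$1 * \<xi>$2 * B * \<phi> x = B * (\<xi>$2 * (k * phi y x))" for B
    unfolding S1[symmetric] by (simp add: power2_eq_square algebra_simps)
  show ?thesis
    unfolding mode_odes_def Let_def A d1 d2 d3 d4 e0 \<xi> represents_traction(5)[OF lam y R \<xi> x]
      DERIV_imp_deriv[OF represents_derivs(3)[OF y R x]]
  proof (intro conjI)
    have e1: "\<xi>$1 / k * (?p' + k * (lam * (e' * psi y x + e x * dpsi lam x (y x)))) =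
      (lam\<^sup>2 * \<rho> x + lam * e x * k\<^sup>2) * \<phi> x + bulk lam x * (\<xi>$1 * (k * phi y x))
       + \<xi>$1 * ((bulk lam x - lam * e x) * dpsi lam x (y x) - g * \<rho> x * psi y x + lam * (e' * psi y x + e x * dpsi lam x (y x)))"
      unfolding eqs[OF x] using k by (simp add: field_simps power2_eq_square)
    have e2: "\<xi>$2 / k * (?p' + k * (lam * (e' * psi y x + e x * dpsi lam x (y x)))) =
      (lam\<^sup>2 * \<rho> x + lam * e x * k\<^sup>2) * \<theta> x + bulk lam x * (\<xi>$2 * (k * phi y x))
       + \<xi>$2 * ((bulk lam x - lam * e x) * dpsi lam x (y x) - g * \<rho> x * psi y x + lam * (e' * psi y x + e x * dpsi lam x (y x)))"
      unfolding eqs[OF x] using k by (simp add: field_simps power2_eq_square)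
    show "- (\<xi>$1 / k * (?p' + k * (lam * (e' * psi y x + e x * dpsi lam x (y x))))) +
      (lam\<^sup>2 * \<rho>0 x + lam * \<epsilon>0 x * k\<^sup>2 + (\<xi>$1)\<^sup>2 * bulk lam x) * \<phi> x =
      - \<xi>$1 * (bulk lam x * dpsi lam x (y x) + (lam * e' - g * \<rho>0 x) * \<psi> x) - \<xi>$1 * \<xi>$2 * bulk lam x * \<theta> x"
      unfolding e1 o1[symmetric] eqs(1,3,7)[OF x] by (simp add: algebra_simps)
    show "- (\<xi>$2 / k * (?p' + k * (lam * (e' * psi y x + e x * dpsi lam x (y x))))) +
      (lam\<^sup>2 * \<rho>0 x + lam * \<epsilon>0 x * k\<^sup>2 + (\<xi>$2)\<^sup>2 * bulk lam x) * \<theta> x =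
      - \<xi>$2 * (bulk lam x * dpsi lam x (y x) + (lam * e' - g * \<rho>0 x) * \<psi> x) - \<xi>$1 * \<xi>$2 * bulk lam x * \<phi> x"
      unfolding e2 o2[symmetric] eqs(1,3,7)[OF x] by (simp add: algebra_simps)
  qed (simp add: eqs(1,3,7)[OF x] algebra_simps)
qed

lemma flow_continuous:
  assumes lam: "0 < lam" and y: "flow lam y"
  shows "continuous_on layer (phi y)" "continuous_on layer (psi y)" "continuous_on layer (tangential y)"
    "continuous_on layer (\<lambda>x. bulk lam x * (dpsi lam x (y x) + k * phi y x))"
    "continuous_on layer (\<lambda>x. lam * e x * (dpsi lam x (y x) - k * phi y x))"
proof -
  note D = flow_components[OF y]
  show c: "continuous_on layer (phi y)" "continuous_on layer (psi y)" "continuous_on layer (tangential y)"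
    by (rule DERIV_continuous_on[OF D(1)] DERIV_continuous_on[OF D(2)] DERIV_continuous_on[OF D(3)]; assumption)+
  have n: "continuous_on layer (normal y)"
    by (rule DERIV_continuous_on[OF D(4)])
  have b: "continuous_on layer (bulk lam)"
    unfolding bulk_def[abs_def] by (intro continuous_intros \<rho>_cont Q_cont e_cont d_cont) auto
  have "bulk lam x + lam * e x \<noteq> 0" if "x \<in> layer" for x
    using mult_pos_pos[OF lam e_pos[OF that]] bulk_pos[OF lam that] by auto
  then have "continuous_on layer (\<lambda>x. dpsi lam x (y x))"
    unfolding dpsi_def split_beta by (intro continuous_intros b c n e_cont) auto
  then show "continuous_on layer (\<lambda>x. bulk lam x * (dpsi lam x (y x) + k * phi y x))"
    "continuous_on layer (\<lambda>x. lam * e x * (dpsi lam x (y x) - k * phi y x))"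
    by (intro continuous_on_mult continuous_on_add continuous_on_diff continuous_on_const b c(1) e_cont; assumption)+
qed

end

section \<open>Matching the two layers\<close>

locale two_layers =
  lower: fluid_layer g k "- m" \<rho>m Qm em dm + upper: fluid_layer g k l \<rho>p Qp ep dp
  for g k m l :: real and \<rho>m Qm em dm \<rho>p Qp ep dp :: "real \<Rightarrow> real" +
  fixes \<sigma> :: real
  assumes m: "0 < m" and l: "0 < l" and \<sigma>: "0 \<le> \<sigma>"
    and unstable: "\<sigma> * k\<^sup>2 < g * (\<rho>p 0 - \<rho>m 0)"
begin

lemma orientation: "lower.orientation = 1" "upper.orientation = - 1"
  using m l by (simp_all add: lower.orientation_def upper.orientation_def)

text \<open>In terms of the interface values \<open>v = (\<phi>(0), \<psi>(0))\<close> the remaining conditions say that the symmetric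
  matrix \<open>N(\<lambda>)\<close> with entries \<open>a\<close>, \<open>b\<close>, \<open>b\<close>, \<open>c\<close>, the total of the tractions of both layers and of surface
  tension, annihilates \<open>v\<close>. Always \<open>a > 0\<close>, because a layer is stable when \<open>\<psi>(0) = 0\<close>. For large \<open>\<lambda>\<close> the
  matrix is positive definite. For small \<open>\<lambda>\<close> the test displacement gives \<open>c < 0\<close>, since the jump of
  the density beats surface tension. Hence \<open>a c - b\<^sup>2\<close> has a zero, where \<open>v = (-b, a)\<close> works.\<close>

lemma growing_mode:
  obtains lam y z where "0 < lam" "lower.flow lam y" "upper.flow lam z"
    "lower.phi y (- m) = 0" "lower.psi y (- m) = 0" "upper.phi z l = 0" "upper.psi z l = 0"
    "lower.phi y 0 = upper.phi z 0" "lower.psi y 0 = upper.psi z 0" "lower.psi y 0 \<noteq> 0"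
    "lower.tangential y 0 = upper.tangential z 0"
    "upper.normal z 0 - lower.normal y 0 = \<sigma> * k\<^sup>2 * lower.psi y 0"
proof -
  obtain C1 where C1: "\<And>lam y. 0 < lam \<Longrightarrow> lam \<le> 1 \<Longrightarrow> lower.flow lam y \<Longrightarrow> lower.phi y (- m) = 0 \<Longrightarrow>
      lower.psi y (- m) = 0 \<Longrightarrow> lower.phi y 0 = 0 \<Longrightarrow> lower.psi y 0 = 1 \<Longrightarrow>
      lower.normal y 0 \<le> g * \<rho>m 0 + lam * C1"
    using lower.flow_traction_bound unfolding orientation by auto
  obtain C2 where C2: "\<And>lam y. 0 < lam \<Longrightarrow> lam \<le> 1 \<Longrightarrow> upper.flow lam y \<Longrightarrow> upper.phi y l = 0 \<Longrightarrow>
      upper.psi y l = 0 \<Longrightarrow> upper.phi y 0 = 0 \<Longrightarrow> upper.psi y 0 = 1 \<Longrightarrow>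
      - upper.normal y 0 \<le> - (g * \<rho>p 0) + lam * C2"
    using upper.flow_traction_bound unfolding orientation by auto
  define gap where "gap = g * (\<rho>p 0 - \<rho>m 0) - \<sigma> * k\<^sup>2"
  have gap: "0 < gap" using unstable by (simp add: gap_def)
  define bnd where "bnd = \<bar>C1 + C2\<bar> + 1"
  have bnd: "0 < bnd" "C1 + C2 \<le> bnd" by (auto simp: bnd_def)
  \<comment> \<open>Small enough for the terms of order \<open>\<lambda>\<close> in the test energy not to fill the gap.\<close>
  define lo where "lo = min 1 (gap / (2 * bnd))"
  \<comment> \<open>From this growth rate on, inertia dominates buoyancy.\<close>
  define hi where "hi = 2 + g * k"
  have gk: "0 < g * k" using lower.g lower.k by simp
  have "0 < gap / (2 * bnd)" using gap bnd by simp
  then have lo: "0 < lo" "lo \<le> 1" by (simp_all only: lo_def min_less_iff_conj) auto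
  have loC: "lo * (C1 + C2) < gap"
  proof -
    have "lo * (C1 + C2) \<le> lo * bnd" using lo bnd by (intro mult_left_mono) auto
    also have "\<dots> \<le> gap / (2 * bnd) * bnd"
      using bnd by (intro mult_right_mono) (auto simp: lo_def)
    also have "\<dots> = gap / 2" using bnd by simp
    also have "\<dots> < gap" using gap by simp
    finally show ?thesis .
  qed
  have hi: "lo \<le> hi" "0 < hi" "g * k < hi\<^sup>2"
  proof -
    show "lo \<le> hi" "0 < hi" using lo gk by (simp_all add: hi_def)
    have "hi * 1 \<le> hi * hi" using gk by (intro mult_left_mono) (auto simp: hi_def)
    then show "g * k < hi\<^sup>2" by (simp add: power2_eq_square) (simp add: hi_def)
  qed
  obtain U V where
    U: "\<And>lam. lam \<in> {lo..hi} \<Longrightarrow> lower.flow lam (U lam) \<and> lower.phi (U lam) (- m) = 0 \<and>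
        lower.psi (U lam) (- m) = 0 \<and> lower.phi (U lam) 0 = 1 \<and> lower.psi (U lam) 0 = 0"
    and V: "\<And>lam. lam \<in> {lo..hi} \<Longrightarrow> lower.flow lam (V lam) \<and> lower.phi (V lam) (- m) = 0 \<and>
        lower.psi (V lam) (- m) = 0 \<and> lower.phi (V lam) 0 = 0 \<and> lower.psi (V lam) 0 = 1"
    and UVc [continuous_intros]: "continuous_on {lo..hi} (\<lambda>lam. U lam 0)" "continuous_on {lo..hi} (\<lambda>lam. V lam 0)"
    using lower.traction_matrix[OF lo(1) hi(1)] by metis
  obtain X Z where
    X: "\<And>lam. lam \<in> {lo..hi} \<Longrightarrow> upper.flow lam (X lam) \<and> upper.phi (X lam) l = 0 \<and>
        upper.psi (X lam) l = 0 \<and> upper.phi (X lam) 0 = 1 \<and> upper.psi (X lam) 0 = 0"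
    and Z: "\<And>lam. lam \<in> {lo..hi} \<Longrightarrow> upper.flow lam (Z lam) \<and> upper.phi (Z lam) l = 0 \<and>
        upper.psi (Z lam) l = 0 \<and> upper.phi (Z lam) 0 = 0 \<and> upper.psi (Z lam) 0 = 1"
    and XZc [continuous_intros]: "continuous_on {lo..hi} (\<lambda>lam. X lam 0)" "continuous_on {lo..hi} (\<lambda>lam. Z lam 0)"
    using upper.traction_matrix[OF lo(1) hi(1)] by metis
  define a where "a lam = lower.tangential (U lam) 0 - upper.tangential (X lam) 0" for lam
  define b where "b lam = lower.tangential (V lam) 0 - upper.tangential (Z lam) 0" for lam
  define c where "c lam = lower.normal (V lam) 0 - upper.normal (Z lam) 0 + \<sigma> * k\<^sup>2" for lam
  have pos: "0 < lam" if "lam \<in> {lo..hi}" for lam using that lo by auto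
  have sym: "lower.normal (U lam) 0 - upper.normal (X lam) 0 = b lam" if lam: "lam \<in> {lo..hi}" for lam
    using lower.traction_symmetric[of lam "U lam" "V lam"] upper.traction_symmetric[of lam "X lam" "Z lam"]
      U[OF lam] V[OF lam] X[OF lam] Z[OF lam] pos[OF lam] by (simp add: b_def)
  have a: "0 < a lam" if lam: "lam \<in> {lo..hi}" for lam
  proof -
    have "0 < lower.tangential (U lam) 0"
      using lower.flow_energy[of lam "U lam"] lower.layer_ends(2) U[OF lam] pos[OF lam]
      unfolding orientation by (force simp: not_le[symmetric])
    moreover have "upper.tangential (X lam) 0 < 0"
      using upper.flow_energy[of lam "X lam"] upper.layer_ends(2) X[OF lam] pos[OF lam]
      unfolding orientation by (force simp: not_le[symmetric])
    ultimately show ?thesis by (simp add: a_def)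
  qed
  have c_lo: "c lo < 0"
  proof -
    have lam: "lo \<in> {lo..hi}" using hi by simp
    have "lower.normal (V lo) 0 \<le> g * \<rho>m 0 + lo * C1" "- upper.normal (Z lo) 0 \<le> - (g * \<rho>p 0) + lo * C2"
      using C1[OF lo, of "V lo"] C2[OF lo, of "Z lo"] V[OF lam] Z[OF lam] by auto
    then show ?thesis
      using loC by (simp add: c_def gap_def algebra_simps)
  qed
  define det where "det lam = a lam * c lam - (b lam)\<^sup>2" for lam
  define y where "y lam = (\<lambda>x. (- b lam) *\<^sub>R U lam x + a lam *\<^sub>R V lam x)" for lam
  define z where "z lam = (\<lambda>x. (- b lam) *\<^sub>R X lam x + a lam *\<^sub>R Z lam x)" for lam
  have y: "lower.flow lam (y lam)" "lower.phi (y lam) (- m) = 0" "lower.psi (y lam) (- m) = 0"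
    "lower.phi (y lam) 0 = - b lam" "lower.psi (y lam) 0 = a lam" if lam: "lam \<in> {lo..hi}" for lam
    using U[OF lam] V[OF lam] lower.flow_lincomb[of lam "U lam" "V lam" "- b lam" "a lam"]
    by (simp_all add: y_def)
  have z: "upper.flow lam (z lam)" "upper.phi (z lam) l = 0" "upper.psi (z lam) l = 0"
    "upper.phi (z lam) 0 = - b lam" "upper.psi (z lam) 0 = a lam" if lam: "lam \<in> {lo..hi}" for lam
    using X[OF lam] Z[OF lam] upper.flow_lincomb[of lam "X lam" "Z lam" "- b lam" "a lam"]
    by (simp_all add: z_def)
  have traction: "lower.tangential (y lam) 0 - upper.tangential (z lam) 0 = 0"
    "lower.normal (y lam) 0 - upper.normal (z lam) 0 + \<sigma> * k\<^sup>2 * a lam = det lam" if lam: "lam \<in> {lo..hi}" for lam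
  proof -
    have "lower.tangential (y lam) 0 - upper.tangential (z lam) 0 =
      - b lam * (lower.tangential (U lam) 0 - upper.tangential (X lam) 0)
      + a lam * (lower.tangential (V lam) 0 - upper.tangential (Z lam) 0)"
      by (simp add: y_def z_def algebra_simps)
    then show "lower.tangential (y lam) 0 - upper.tangential (z lam) 0 = 0"
      by (simp flip: a_def b_def)
    have "lower.normal (y lam) 0 - upper.normal (z lam) 0 =
      - b lam * (lower.normal (U lam) 0 - upper.normal (X lam) 0)
      + a lam * (lower.normal (V lam) 0 - upper.normal (Z lam) 0)"
      by (simp add: y_def z_def algebra_simps)
    then show "lower.normal (y lam) 0 - upper.normal (z lam) 0 + \<sigma> * k\<^sup>2 * a lam = det lam"
      unfolding sym[OF lam] det_def by (simp add: c_def power2_eq_square algebra_simps)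
  qed
  have det_lo: "det lo < 0"
  proof -
    have "a lo * c lo < 0" using a[of lo] c_lo hi by (simp add: mult_pos_neg)
    then show ?thesis unfolding det_def by (smt (verit) zero_le_power2)
  qed
  have det_hi: "0 < det hi"
  proof -
    have lam: "hi \<in> {lo..hi}" using hi by simp
    note yz = y[OF lam] z[OF lam] a[OF lam]
    have "0 < - b hi * lower.tangential (y hi) 0 + a hi * lower.normal (y hi) 0"
      using lower.flow_traction_pos[OF hi(2,3), of "y hi"] yz unfolding orientation by simp
    moreover have "0 < - (- b hi * upper.tangential (z hi) 0 + a hi * upper.normal (z hi) 0)"
      using upper.flow_traction_pos[OF hi(2,3), of "z hi"] yz unfolding orientation by simp
    ultimately have "0 < - b hi * (lower.tangential (y hi) 0 - upper.tangential (z hi) 0)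
      + a hi * (lower.normal (y hi) 0 - upper.normal (z hi) 0)"
      by (simp add: algebra_simps)
    also have "\<dots> = a hi * (det hi - \<sigma> * k\<^sup>2 * a hi)"
      unfolding traction(1)[OF lam] traction(2)[OF lam, symmetric] by simp
    finally have "0 < det hi - \<sigma> * k\<^sup>2 * a hi"
      using yz by (simp add: zero_less_mult_iff)
    moreover have "0 \<le> \<sigma> * k\<^sup>2 * a hi" using \<sigma> yz by simp
    ultimately show ?thesis by linarith
  qed
  have "continuous_on {lo..hi} det"
    unfolding det_def a_def b_def c_def by (intro continuous_intros UVc XZc)
  then obtain lam where lam: "lam \<in> {lo..hi}" "det lam = 0"
    using IVT'[of det lo 0 hi] det_lo det_hi hi(1) by auto
  show ?thesis
    using that[OF pos[OF lam(1)] y(1)[OF lam(1)] z(1)[OF lam(1)]] y[OF lam(1)] z[OF lam(1)] a[OF lam(1)]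
      traction[OF lam(1)] lam(2) by simp
qed

end

section \<open>Assembling the normal modes\<close>

lemma tendsto_ends_of_interval:
  fixes f F :: "real \<Rightarrow> real"
  assumes ab: "a < b" and F: "continuous_on {a..b} F" and f: "\<And>x. x \<in> {a<..<b} \<Longrightarrow> f x = F x"
  shows "(f \<longlongrightarrow> F b) (at_left b)" "(f \<longlongrightarrow> F a) (at_right a)"
proof -
  have "\<forall>\<^sub>F x in at_left b. F x = f x"
    using eventually_at_left_real[OF ab] by eventually_elim (simp add: f)
  then show "(f \<longlongrightarrow> F b) (at_left b)"
    by (rule Lim_transform_eventually[OF continuous_on_Icc_at_leftD[OF F ab]])
  have "\<forall>\<^sub>F x in at_right a. F x = f x"
    using eventually_at_right_real[OF ab] by eventually_elim (simp add: f)
  then show "(f \<longlongrightarrow> F a) (at_right a)"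
    by (rule Lim_transform_eventually[OF continuous_on_Icc_at_rightD[OF F ab]])
qed

lemma has_jump_of_sides:
  assumes "0 < m" "0 < l" "continuous_on {-m..0} u" "continuous_on {0..l} v"
    "\<And>x. x \<in> {-m<..<0} \<Longrightarrow> f x = u x" "\<And>x. x \<in> {0<..<l} \<Longrightarrow> f x = v x" "J = v 0 - u 0"
  shows "has_jump f J"
  unfolding has_jump_def
  using tendsto_ends_of_interval(1)[of "- m" 0 u f] tendsto_ends_of_interval(2)[of 0 l v f] assms by auto

lemma profile_of_sides:
  assumes ml: "0 < m" "0 < l" and c: "continuous_on {-m..0} u" "continuous_on {0..l} v" and "u 0 = v 0"
    and smooth: "\<And>n. times_differentiable_on n {-m<..<0} u" "\<And>n. times_differentiable_on n {0<..<l} v"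
    and wall: "u (- m) = 0" "v l = 0"
  defines "f \<equiv> \<lambda>x. if x < 0 then u x else v x"
  shows "profile m l (\<lambda>x. a * f x)" "vanishes_at_ends m l (\<lambda>x. a * f x)" "has_jump (\<lambda>x. a * f x) 0"
proof -
  have f: "f x = u x" if "x \<in> {-m<..<0}" for x using that by (simp add: f_def)
  have f': "f x = v x" if "x \<in> {0<..<l}" for x using that by (simp add: f_def)
  note L = tendsto_ends_of_interval[OF _ c(1) f] and R = tendsto_ends_of_interval[OF _ c(2) f']
  have "times_differentiable_on n {-m<..<0} (\<lambda>x. a * f x)" for n
    by (intro times_differentiable_on_mult times_differentiable_on_const
        times_differentiable_on_cong[OF _ f[symmetric] smooth(1)]) auto
  moreover have "times_differentiable_on n {0<..<l} (\<lambda>x. a * f x)" for n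
    by (intro times_differentiable_on_mult times_differentiable_on_const
        times_differentiable_on_cong[OF _ f'[symmetric] smooth(2)]) auto
  moreover have "isCont f 0"
    using L(1) R(2) ml \<open>u 0 = v 0\<close> by (simp add: isCont_def filterlim_at_split f_def)
  ultimately show "profile m l (\<lambda>x. a * f x)"
    by (simp add: profile_def smooth_on_iff)
  show "vanishes_at_ends m l (\<lambda>x. a * f x)"
    unfolding vanishes_at_ends_def using L(2) R(1) ml wall by (auto intro!: tendsto_mult_right_zero)
  have "((\<lambda>x. a * f x) \<longlongrightarrow> a * v 0) (at_right 0)" "((\<lambda>x. a * f x) \<longlongrightarrow> a * v 0) (at_left 0)"
    using L(1) R(2) ml \<open>u 0 = v 0\<close> by (auto intro!: tendsto_mult_left)
  then show "has_jump (\<lambda>x. a * f x) 0"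
    unfolding has_jump_def by force
qed

definition normal_mode ::
  "real \<Rightarrow> real \<Rightarrow> real \<Rightarrow> real \<Rightarrow> (real \<Rightarrow> real) \<Rightarrow> (real \<Rightarrow> real) \<Rightarrow> (real \<Rightarrow> real) \<Rightarrow> (real \<Rightarrow> real) \<Rightarrow>
    real \<Rightarrow> real^2 \<Rightarrow> (real \<Rightarrow> real) \<Rightarrow> (real \<Rightarrow> real) \<Rightarrow> (real \<Rightarrow> real) \<Rightarrow> bool" where
  "normal_mode m l g \<sigma> \<rho>0 dP0 \<epsilon>0 \<delta>0 lam \<xi> \<phi> \<theta> \<psi> \<longleftrightarrow>
     profile m l \<phi> \<and> profile m l \<theta> \<and> profile m l \<psi> \<and>
     (\<forall>x\<in>{-m<..<0} \<union> {0<..<l}. mode_odes g \<rho>0 dP0 \<epsilon>0 \<delta>0 lam \<xi> \<phi> \<theta> \<psi> x) \<and>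
     mode_jump_conditions \<sigma> \<rho>0 dP0 \<epsilon>0 \<delta>0 lam \<xi> \<phi> \<theta> \<psi> \<and>
     vanishes_at_ends m l \<phi> \<and> vanishes_at_ends m l \<theta> \<and> vanishes_at_ends m l \<psi>"

locale smooth_two_layers = two_layers +
  assumes smooth_lower: "\<And>n. times_differentiable_on n {-m<..<0} \<rho>m" "\<And>n. times_differentiable_on n {-m<..<0} Qm"
      "\<And>n. times_differentiable_on n {-m<..<0} em" "\<And>n. times_differentiable_on n {-m<..<0} dm"
    and smooth_upper: "\<And>n. times_differentiable_on n {0<..<l} \<rho>p" "\<And>n. times_differentiable_on n {0<..<l} Qp"
      "\<And>n. times_differentiable_on n {0<..<l} ep" "\<And>n. times_differentiable_on n {0<..<l} dp"
begin

text \<open>Horizontally the planar solution moves along the wave vector, so one pair \<open>(f, h)\<close> and one growth rate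
  serve all wave vectors of length \<open>k\<close>; equivariance is then built in.\<close>

lemma growing_normal_mode:
  assumes coeffs: "\<And>x. x \<in> {-m<..<0} \<Longrightarrow> \<rho>0 x = \<rho>m x \<and> dP0 x = Qm x \<and> \<epsilon>0 x = em x \<and> \<delta>0 x = dm x"
    "\<And>x. x \<in> {0<..<l} \<Longrightarrow> \<rho>0 x = \<rho>p x \<and> dP0 x = Qp x \<and> \<epsilon>0 x = ep x \<and> \<delta>0 x = dp x"
  obtains lam f h where "0 < lam" "h 0 \<noteq> 0"
    "\<And>\<xi> :: real^2. norm \<xi> = k \<Longrightarrow> normal_mode m l g \<sigma> \<rho>0 dP0 \<epsilon>0 \<delta>0 lam \<xi>
      (\<lambda>x. \<xi>$1 / k * f x) (\<lambda>x. \<xi>$2 / k * f x) h"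
proof -
  have mm [simp]: "min (- m) 0 = - m" "max (- m) 0 = 0" "min l 0 = 0" "max l 0 = l"
    using m l by auto
  obtain lam y z where lam: "0 < lam" and y: "lower.flow lam y" and z: "upper.flow lam z"
    and wall: "lower.phi y (- m) = 0" "lower.psi y (- m) = 0" "upper.phi z l = 0" "upper.psi z l = 0"
    and match: "lower.phi y 0 = upper.phi z 0" "lower.psi y 0 = upper.psi z 0" "lower.psi y 0 \<noteq> 0"
      "lower.tangential y 0 = upper.tangential z 0"
      "upper.normal z 0 - lower.normal y 0 = \<sigma> * k\<^sup>2 * lower.psi y 0"
    by (rule growing_mode)
  define f where "f x = (if x < 0 then lower.phi y x else upper.phi z x)" for x
  define h where "h x = (if x < 0 then lower.psi y x else upper.psi z x)" for x
  note cy = lower.flow_continuous[OF lam y, unfolded mm] and cz = upper.flow_continuous[OF lam z, unfolded mm]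
  note sy = lower.flow_times_differentiable[OF lam y, unfolded mm, OF smooth_lower]
    and sz = upper.flow_times_differentiable[OF lam z, unfolded mm, OF smooth_upper]
  have F: "profile m l (\<lambda>x. a * f x)" "vanishes_at_ends m l (\<lambda>x. a * f x)" "has_jump (\<lambda>x. a * f x) 0" for a
    unfolding f_def using profile_of_sides[OF m l cy(1) cz(1) match(1) _ _ wall(1,3), of a] sy sz by blast+
  have H: "profile m l (\<lambda>x. a * h x)" "vanishes_at_ends m l (\<lambda>x. a * h x)" "has_jump (\<lambda>x. a * h x) 0" for a
    unfolding h_def using profile_of_sides[OF m l cy(2) cz(2) match(2) _ _ wall(2,4), of a] sy sz by blast+
  show ?thesis
  proof (rule that[where f = f and h = h, OF lam])
    show "h 0 \<noteq> 0" using match by (simp add: h_def)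
    fix \<xi> :: "real^2" assume \<xi>: "norm \<xi> = k"
    define \<phi> \<theta> where \<phi>: "\<phi> = (\<lambda>x. \<xi>$1 / k * f x)" and \<theta>: "\<theta> = (\<lambda>x. \<xi>$2 / k * f x)"
    have Ry: "lower.represents lam y \<xi> \<rho>0 dP0 \<epsilon>0 \<delta>0 \<phi> \<theta> h"
      unfolding lower.represents_def using coeffs(1) by (auto simp: \<phi> \<theta> f_def h_def)
    have Rz: "upper.represents lam z \<xi> \<rho>0 dP0 \<epsilon>0 \<delta>0 \<phi> \<theta> h"
      unfolding upper.represents_def using coeffs(2) by (auto simp: \<phi> \<theta> f_def h_def)
    note ty = lower.represents_traction[OF lam y Ry \<xi>, unfolded mm] and tz = upper.represents_traction[OF lam z Rz \<xi>, unfolded mm]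
    have odes: "mode_odes g \<rho>0 dP0 \<epsilon>0 \<delta>0 lam \<xi> \<phi> \<theta> h x" if "x \<in> {-m<..<0} \<union> {0<..<l}" for x
      using that lower.represents_mode_odes[OF lam y Ry \<xi>, unfolded mm, OF _ smooth_lower(2,3,4)]
        upper.represents_mode_odes[OF lam z Rz \<xi>, unfolded mm, OF _ smooth_upper(2,3,4)] by auto
    define J1 where "J1 = upper.bulk lam 0 * (upper.dpsi lam 0 (z 0) + k * upper.phi z 0)
        - lower.bulk lam 0 * (lower.dpsi lam 0 (y 0) + k * lower.phi y 0)"
    define J2 where "J2 = lam * ep 0 * (upper.dpsi lam 0 (z 0) - k * upper.phi z 0)
        - lam * em 0 * (lower.dpsi lam 0 (y 0) - k * lower.phi y 0)"
    have J: "J1 + J2 = \<sigma> * (norm \<xi>)\<^sup>2 * h 0"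
    proof -
      have "J1 + J2 = upper.normal z 0 - lower.normal y 0"
        unfolding lower.stress_relations(2)[OF lam lower.layer_ends(2), of y]
          upper.stress_relations(2)[OF lam upper.layer_ends(2), of z]
        by (simp add: J1_def J2_def algebra_simps)
      then show ?thesis using match by (simp add: \<xi> h_def)
    qed
    have bulk_jump: "has_jump (\<lambda>x. (lam * \<delta>0 x + lam * \<epsilon>0 x / 3 + dP0 x * \<rho>0 x) * (deriv h x + \<xi>$1 * \<phi> x + \<xi>$2 * \<theta> x)) J1"
        by (rule has_jump_of_sides[OF m l cy(4) cz(4) ty(3) tz(3)]) (auto simp: J1_def)
    have shear_jump: "has_jump (\<lambda>x. lam * \<epsilon>0 x * (deriv h x - \<xi>$1 * \<phi> x - \<xi>$2 * \<theta> x)) J2"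
        by (rule has_jump_of_sides[OF m l cy(5) cz(5) ty(4) tz(4)]) (auto simp: J2_def)
    have "mode_jump_conditions \<sigma> \<rho>0 dP0 \<epsilon>0 \<delta>0 lam \<xi> \<phi> \<theta> h"
      unfolding mode_jump_conditions_def
    proof (intro conjI)
      show "has_jump \<phi> 0" "has_jump \<theta> 0" unfolding \<phi> \<theta> by (rule F)+
      show "has_jump h 0" using H(3)[of 1] by simp
      show "has_jump (\<lambda>x. lam * \<epsilon>0 x * (deriv \<phi> x - \<xi>$1 * h x)) 0"
        by (rule has_jump_of_sides[OF m l continuous_on_mult[OF continuous_on_const cy(3)]
              continuous_on_mult[OF continuous_on_const cz(3)] ty(1) tz(1)]) (auto simp: match)
      show "has_jump (\<lambda>x. lam * \<epsilon>0 x * (deriv \<theta> x - \<xi>$2 * h x)) 0"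
        by (rule has_jump_of_sides[OF m l continuous_on_mult[OF continuous_on_const cy(3)]
              continuous_on_mult[OF continuous_on_const cz(3)] ty(2) tz(2)]) (auto simp: match)
      show "\<exists>J1 J2. has_jump (\<lambda>x. (lam * \<delta>0 x + lam * \<epsilon>0 x / 3 + dP0 x * \<rho>0 x) * (deriv h x + \<xi>$1 * \<phi> x + \<xi>$2 * \<theta> x)) J1 \<and>
        has_jump (\<lambda>x. lam * \<epsilon>0 x * (deriv h x - \<xi>$1 * \<phi> x - \<xi>$2 * \<theta> x)) J2 \<and> J1 + J2 = \<sigma> * (norm \<xi>)\<^sup>2 * h 0"
        using J bulk_jump shear_jump by blast
    qed
    then show "normal_mode m l g \<sigma> \<rho>0 dP0 \<epsilon>0 \<delta>0 lam \<xi> (\<lambda>x. \<xi>$1 / k * f x) (\<lambda>x. \<xi>$2 / k * f x) h"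
      using odes F[of "\<xi>$1 / k"] F[of "\<xi>$2 / k"] H[of 1] unfolding \<phi> \<theta> normal_mode_def by simp
  qed
qed

end

lemma has_jump_unique: "has_jump f J \<Longrightarrow> jump f = J"
  unfolding jump_def
  by (rule the_equality) (auto simp: has_jump_def dest: tendsto_unique[OF trivial_limit_at_right_real] tendsto_unique[OF trivial_limit_at_left_real])

lemma interface_density:
  assumes "pressure_law Pp" and rm: "rm \<in> interface_densities Pp Pm"
  defines "rp \<equiv> the_inv_into {0<..} Pp (Pm rm)"
  shows "0 < rm" "rm < rp" "Pp rp = Pm rm"
proof -
  have mono: "strict_mono_on {0<..} Pp" using assms(1) by (simp add: pressure_law_def)
  then have inj: "inj_on Pp {0<..}" by (rule strict_mono_on_imp_inj_on)
  have im: "Pm rm \<in> Pp ` {0<..}" and gt: "Pp rm < Pm rm" and pos: "0 < rm"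
    using rm by (auto simp: interface_densities_def)
  show "0 < rm" by (rule pos)
  show eq: "Pp rp = Pm rm" unfolding rp_def by (rule f_the_inv_into_f[OF inj im])
  have rp: "rp \<in> {0<..}" unfolding rp_def by (rule the_inv_into_into[OF inj im order_refl])
  show "rm < rp"
  proof (rule ccontr)
    assume "\<not> rm < rp"
    then have "Pp rp \<le> Pp rm"
      using strict_mono_on_leD[OF mono] rp pos by simp
    then show False using eq gt by simp
  qed
qed

text \<open>The coefficients of a layer in hydrostatic equilibrium are smooth across both ends, so they are
  continuous on the closed layer and smooth inside.\<close>

lemma hydrostatic_layer:
  assumes g: "0 < g" and k: "0 < k" and w: "w \<noteq> 0" and P: "pressure_law P" and r0: "0 < r0"
    and h: "enthalpy P r0 - g * w \<in> enthalpy P ` {0<..}"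
    and ed: "smooth_on {0<..} \<epsilon>" "smooth_on {0<..} \<delta>" "\<And>z. 0 < z \<Longrightarrow> 0 < \<epsilon> z \<and> 0 \<le> \<delta> z"
  defines "r \<equiv> \<lambda>x. the_inv_into {0<..} (enthalpy P) (enthalpy P r0 - g * x)"
  shows "fluid_layer g k w r (\<lambda>x. deriv P (r x)) (\<lambda>x. \<epsilon> (r x)) (\<lambda>x. \<delta> (r x))"
    and "times_differentiable_on n {min w 0<..<max w 0} r"
    and "times_differentiable_on n {min w 0<..<max w 0} (\<lambda>x. deriv P (r x))"
    and "times_differentiable_on n {min w 0<..<max w 0} (\<lambda>x. \<epsilon> (r x))"
    and "times_differentiable_on n {min w 0<..<max w 0} (\<lambda>x. \<delta> (r x))"
    and "r 0 = r0"
proof -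
  obtain I where I: "open I" "closed_segment w 0 \<subseteq> I" and r_0: "r 0 = r0"
    and pos: "\<And>x. x \<in> I \<Longrightarrow> r x > 0"
    and der: "\<And>x. x \<in> I \<Longrightarrow> (r has_real_derivative - g * r x / deriv P (r x)) (at x)"
    using hydrostatic_density[OF P r0 h] unfolding r_def by metis
  have sub: "{min w 0..max w 0} \<subseteq> I"
    using I(2) by (auto simp: closed_segment_eq_real_ivl min_def max_def split: if_splits)
  have sub': "{min w 0<..<max w 0} \<subseteq> I" using sub by force
  have smP: "smooth_on {0<..} P" using P by (simp add: pressure_law_def)
  have Ppos: "\<And>z. z > 0 \<Longrightarrow> deriv P z > 0" by (rule pressure_law_deriv_pos[OF P])
  have td: "times_differentiable_on n I r" for n
    by (rule hydrostatic_density_times_differentiable[OF smP Ppos pos der])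
  have comp: "times_differentiable_on n I (\<lambda>x. F (r x))" if "smooth_on {0<..} F" for F n
    using pos by (intro times_differentiable_on_compose[where f = F and g = r and T = "{0<..}",
        OF _ smooth_on_imp_times_differentiable_on[OF that] td]) auto
  have cr: "continuous_on I r"
    using der by (auto intro!: continuous_at_imp_continuous_on intro: DERIV_isCont)
  have cont: "continuous_on {min w 0..max w 0} (\<lambda>x. F (r x))" if "smooth_on {0<..} F" for F
    using pos sub by (intro continuous_on_compose2[OF smooth_on_continuous_on[OF that] continuous_on_subset[OF cr]]) auto
  have mem: "x \<in> I" if "x \<in> {min w 0..max w 0}" for x using that sub by blast
  show "fluid_layer g k w r (\<lambda>x. deriv P (r x)) (\<lambda>x. \<epsilon> (r x)) (\<lambda>x. \<delta> (r x))"
  proof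
    show "0 < g" "0 < k" "w \<noteq> 0" by fact+
    fix x assume x: "x \<in> {min w 0..max w 0}"
    show "0 < r x" "0 < deriv P (r x)" "0 < \<epsilon> (r x)" "0 \<le> \<delta> (r x)"
      using pos[OF mem[OF x]] Ppos ed(3) by auto
    show "(r has_real_derivative - g * r x / deriv P (r x)) (at x within {min w 0..max w 0})"
      by (rule DERIV_subset[OF der[OF mem[OF x]] subset_UNIV])
  qed (intro cont smooth_on_deriv smP ed)+
  show "times_differentiable_on n {min w 0<..<max w 0} r"
    by (rule times_differentiable_on_subset[OF td sub'])
  show "times_differentiable_on n {min w 0<..<max w 0} (\<lambda>x. deriv P (r x))"
    by (rule times_differentiable_on_subset[OF comp[OF smooth_on_deriv[OF smP]] sub'])
  show "times_differentiable_on n {min w 0<..<max w 0} (\<lambda>x. \<epsilon> (r x))"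
    by (rule times_differentiable_on_subset[OF comp[OF ed(1)] sub'])
  show "times_differentiable_on n {min w 0<..<max w 0} (\<lambda>x. \<delta> (r x))"
    by (rule times_differentiable_on_subset[OF comp[OF ed(2)] sub'])
  show "r 0 = r0" by (rule r_0)
qed

lemma rotation_norm:
  fixes R :: "real^2^2"
  assumes "rotation_matrix R"
  shows "norm (R *v \<xi>) = norm \<xi>"
  using assms orthogonal_transformation_norm[of "(*v) R"]
  by (simp add: rotation_matrix_def orthogonal_transformation_matrix)

theorem theorem2p1:
  fixes g \<sigma> m l rm rp :: real
    and Pp Pm \<epsilon>p \<epsilon>m \<delta>p \<delta>m \<rho>0 dP0 \<epsilon>0 \<delta>0 :: "real \<Rightarrow> real"
  assumes "g > 0" and "\<sigma> \<ge> 0" and "m > 0" and "l > 0"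
    and "pressure_law Pp" and "pressure_law Pm"
    and "smooth_on {0<..} \<epsilon>p" and "smooth_on {0<..} \<epsilon>m"
    and "smooth_on {0<..} \<delta>p" and "smooth_on {0<..} \<delta>m"
    and "\<forall>z>0. \<epsilon>p z > 0 \<and> \<epsilon>m z > 0 \<and> \<delta>p z \<ge> 0 \<and> \<delta>m z \<ge> 0"
    and "rm \<in> interface_densities Pp Pm"
    and "rp = the_inv_into {0<..} Pp (Pm rm)"
    and "enthalpy Pm rm + g * m \<in> enthalpy Pm ` {0<..}"
    and "enthalpy Pp rp - g * l \<in> enthalpy Pp ` {0<..}"
    and "\<rho>0 = steady_density g Pp Pm rp rm"
    and "dP0 = two_phase (deriv Pp) (deriv Pm) \<rho>0"
    and "\<epsilon>0 = two_phase \<epsilon>p \<epsilon>m \<rho>0"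
    and "\<delta>0 = two_phase \<delta>p \<delta>m \<rho>0"
  shows "\<exists>(\<Lambda> :: real \<Rightarrow> real) (\<phi> :: real^2 \<Rightarrow> real \<Rightarrow> real) (\<theta> :: real^2 \<Rightarrow> real \<Rightarrow> real)
           (\<psi> :: real^2 \<Rightarrow> real \<Rightarrow> real).
      (\<forall>k. 0 < k \<and> ereal k < xi_crit g \<sigma> \<rho>0 \<longrightarrow> \<Lambda> k > 0) \<and>
      (\<forall>\<xi> :: real^2. 0 < (norm \<xi>)\<^sup>2 \<and> ereal ((norm \<xi>)\<^sup>2) < xi_crit_sq g \<sigma> \<rho>0 \<longrightarrow>
         profile m l (\<phi> \<xi>) \<and> profile m l (\<theta> \<xi>) \<and> profile m l (\<psi> \<xi>) \<and>
         \<psi> \<xi> 0 \<noteq> 0 \<and>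
         (\<forall>x \<in> {-m<..<0} \<union> {0<..<l}.
            mode_odes g \<rho>0 dP0 \<epsilon>0 \<delta>0 (\<Lambda> (norm \<xi>)) \<xi> (\<phi> \<xi>) (\<theta> \<xi>) (\<psi> \<xi>) x) \<and>
         mode_jump_conditions \<sigma> \<rho>0 dP0 \<epsilon>0 \<delta>0 (\<Lambda> (norm \<xi>)) \<xi> (\<phi> \<xi>) (\<theta> \<xi>) (\<psi> \<xi>) \<and>
         vanishes_at_ends m l (\<phi> \<xi>) \<and> vanishes_at_ends m l (\<theta> \<xi>) \<and>
         vanishes_at_ends m l (\<psi> \<xi>) \<and>
         (\<forall>R :: real^2^2. rotation_matrix R \<longrightarrow>
            (\<forall>x \<in> {-m<..<l}.
               (vector [\<phi> (R *v \<xi>) x, \<theta> (R *v \<xi>) x, \<psi> (R *v \<xi>) x] :: real^3) =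
               (vector [vector [R$1$1, R$1$2, 0],
                        vector [R$2$1, R$2$2, 0],
                        vector [0, 0, 1]] :: real^3^3) *v
               vector [\<phi> \<xi> x, \<theta> \<xi> x, \<psi> \<xi> x])))"
proof -
  define r_m r_p where "r_m x = the_inv_into {0<..} (enthalpy Pm) (enthalpy Pm rm - g * x)"
    and "r_p x = the_inv_into {0<..} (enthalpy Pp) (enthalpy Pp rp - g * x)" for x
  have rm: "0 < rm" "rm < rp"
    using interface_density[OF assms(5,12)] unfolding assms(13) by auto
  have low: "enthalpy Pm rm - g * (- m) \<in> enthalpy Pm ` {0<..}"
    using assms(14) by simp
  have rp: "0 < rp" and m0: "- m \<noteq> 0" and l0: "l \<noteq> 0" using rm assms(3,4) by auto
  have mm [simp]: "min (- m) 0 = - m" "max (- m) 0 = 0" "min l 0 = 0" "max l 0 = l"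
    using assms(3,4) by auto
  have visc_m: "\<And>z. 0 < z \<Longrightarrow> 0 < \<epsilon>m z \<and> 0 \<le> \<delta>m z" and visc_p: "\<And>z. 0 < z \<Longrightarrow> 0 < \<epsilon>p z \<and> 0 \<le> \<delta>p z"
    using assms(11) by auto
  note lower = hydrostatic_layer[OF assms(1) _ m0 assms(6) rm(1) low assms(8,10) visc_m, folded r_m_def, unfolded mm]
    and upper = hydrostatic_layer[OF assms(1) _ l0 assms(5) rp assms(15) assms(7,9) visc_p, folded r_p_def, unfolded mm]
  have coeffs_m: "\<rho>0 x = r_m x \<and> dP0 x = deriv Pm (r_m x) \<and> \<epsilon>0 x = \<epsilon>m (r_m x) \<and> \<delta>0 x = \<delta>m (r_m x)"
    if "x \<in> {-m<..<0}" for x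
    using that by (simp add: assms(16-19) two_phase_def steady_density_def r_m_def)
  have coeffs_p: "\<rho>0 x = r_p x \<and> dP0 x = deriv Pp (r_p x) \<and> \<epsilon>0 x = \<epsilon>p (r_p x) \<and> \<delta>0 x = \<delta>p (r_p x)"
    if "x \<in> {0<..<l}" for x
    using that by (simp add: assms(16-19) two_phase_def steady_density_def r_p_def)
  have traces: "r_m 0 = rm" "r_p 0 = rp"
    using lower(6)[of 1] upper(6)[of 1] by simp_all
  have "has_jump \<rho>0 (rp - rm)"
    using has_jump_of_sides[of m l r_m r_p \<rho>0] assms(3,4) coeffs_m coeffs_p traces
      fluid_layer.\<rho>_cont[OF lower(1)[of 1]] fluid_layer.\<rho>_cont[OF upper(1)[of 1]]
    by simp
  then have jump: "jump \<rho>0 = rp - rm" by (rule has_jump_unique)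
  define unstable where "unstable k \<longleftrightarrow> 0 < k \<and> \<sigma> * k\<^sup>2 < g * (rp - rm)" for k
  have crit: "unstable k" if "0 < k" "ereal (k\<^sup>2) < xi_crit_sq g \<sigma> \<rho>0" for k
    using that assms(1,2) rm(2) by (auto simp: unstable_def xi_crit_sq_def jump field_simps split: if_splits)
  define solves where "solves k lam f h \<longleftrightarrow> (0::real) < lam \<and> h 0 \<noteq> (0::real) \<and>
    (\<forall>\<xi> :: real^2. norm \<xi> = k \<longrightarrow> normal_mode m l g \<sigma> \<rho>0 dP0 \<epsilon>0 \<delta>0 lam \<xi>
      (\<lambda>x. \<xi>$1 / k * f x) (\<lambda>x. \<xi>$2 / k * f x) h)" for k lam f h
  have "\<exists>lam f h. solves k lam f h" if k: "unstable k" for k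
  proof -
    have k0: "0 < k" using k by (simp add: unstable_def)
    interpret smooth_two_layers g k m l r_m "\<lambda>x. deriv Pm (r_m x)" "\<lambda>x. \<epsilon>m (r_m x)" "\<lambda>x. \<delta>m (r_m x)"
      r_p "\<lambda>x. deriv Pp (r_p x)" "\<lambda>x. \<epsilon>p (r_p x)" "\<lambda>x. \<delta>p (r_p x)" \<sigma>
    proof (intro smooth_two_layers.intro two_layers.intro two_layers_axioms.intro smooth_two_layers_axioms.intro)
      show "\<sigma> * k\<^sup>2 < g * (r_p 0 - r_m 0)" using k by (simp add: unstable_def traces)
      show "0 < m" "0 < l" "0 \<le> \<sigma>" by fact+
      show "fluid_layer g k (- m) r_m (\<lambda>x. deriv Pm (r_m x)) (\<lambda>x. \<epsilon>m (r_m x)) (\<lambda>x. \<delta>m (r_m x))"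
        by (rule lower(1)[OF k0])
      show "fluid_layer g k l r_p (\<lambda>x. deriv Pp (r_p x)) (\<lambda>x. \<epsilon>p (r_p x)) (\<lambda>x. \<delta>p (r_p x))"
        by (rule upper(1)[OF k0])
      fix n
      show "times_differentiable_on n {-m<..<0} r_m" by (rule lower(2)[OF k0])
      show "times_differentiable_on n {-m<..<0} (\<lambda>x. deriv Pm (r_m x))" by (rule lower(3)[OF k0])
      show "times_differentiable_on n {-m<..<0} (\<lambda>x. \<epsilon>m (r_m x))" by (rule lower(4)[OF k0])
      show "times_differentiable_on n {-m<..<0} (\<lambda>x. \<delta>m (r_m x))" by (rule lower(5)[OF k0])
      show "times_differentiable_on n {0<..<l} r_p" by (rule upper(2)[OF k0])
      show "times_differentiable_on n {0<..<l} (\<lambda>x. deriv Pp (r_p x))" by (rule upper(3)[OF k0])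
      show "times_differentiable_on n {0<..<l} (\<lambda>x. \<epsilon>p (r_p x))" by (rule upper(4)[OF k0])
      show "times_differentiable_on n {0<..<l} (\<lambda>x. \<delta>p (r_p x))" by (rule upper(5)[OF k0])
    qed
    show ?thesis
      by (rule growing_normal_mode[OF coeffs_m coeffs_p]) (auto simp only: solves_def)
  qed
  then obtain \<Lambda>0 f h where sol: "\<And>k. unstable k \<Longrightarrow> solves k (\<Lambda>0 k) (f k) (h k)"
    by metis
  \<comment> \<open>Outside the unstable range the growth rate is an arbitrary positive number.\<close>
  define \<Lambda> where "\<Lambda> k = (if unstable k then \<Lambda>0 k else 1)" for k
  have \<Lambda>: "0 < \<Lambda> k" for k
    using sol[of k] by (auto simp: \<Lambda>_def solves_def)
  define \<phi> \<theta> \<psi> :: "real^2 \<Rightarrow> real \<Rightarrow> real" where "\<phi> \<xi> = (\<lambda>x. \<xi>$1 / norm \<xi> * f (norm \<xi>) x)"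
    and "\<theta> \<xi> = (\<lambda>x. \<xi>$2 / norm \<xi> * f (norm \<xi>) x)" and "\<psi> \<xi> = h (norm \<xi>)" for \<xi>
  have equivariant: "(vector [\<phi> (R *v \<xi>) x, \<theta> (R *v \<xi>) x, \<psi> (R *v \<xi>) x] :: real^3) =
      (vector [vector [R$1$1, R$1$2, 0], vector [R$2$1, R$2$2, 0], vector [0, 0, 1]] :: real^3^3) *v
      vector [\<phi> \<xi> x, \<theta> \<xi> x, \<psi> \<xi> x]" if "rotation_matrix R" for R :: "real^2^2" and \<xi> x
    unfolding \<phi>_def \<theta>_def \<psi>_def rotation_norm[OF that]
    by (simp add: vec_eq_iff forall_3 vector_3 matrix_vector_mult_def sum_3 sum_2 add_divide_distrib algebra_simps)
  show ?thesis
  proof (rule exI[of _ \<Lambda>], rule exI[of _ \<phi>], rule exI[of _ \<theta>], rule exI[of _ \<psi>], intro conjI allI impI)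
    show "0 < \<Lambda> k" for k by (rule \<Lambda>)
    fix \<xi> :: "real^2" assume \<xi>: "0 < (norm \<xi>)\<^sup>2 \<and> ereal ((norm \<xi>)\<^sup>2) < xi_crit_sq g \<sigma> \<rho>0"
    then have u: "unstable (norm \<xi>)" by (intro crit) auto
    note S = sol[OF u, unfolded solves_def]
    have main: "normal_mode m l g \<sigma> \<rho>0 dP0 \<epsilon>0 \<delta>0 (\<Lambda> (norm \<xi>)) \<xi> (\<phi> \<xi>) (\<theta> \<xi>) (\<psi> \<xi>)"
      using S u by (simp add: \<Lambda>_def \<phi>_def \<theta>_def \<psi>_def)
    show "profile m l (\<phi> \<xi>)" "profile m l (\<theta> \<xi>)" "profile m l (\<psi> \<xi>)"
      "mode_jump_conditions \<sigma> \<rho>0 dP0 \<epsilon>0 \<delta>0 (\<Lambda> (norm \<xi>)) \<xi> (\<phi> \<xi>) (\<theta> \<xi>) (\<psi> \<xi>)"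
      "vanishes_at_ends m l (\<phi> \<xi>)" "vanishes_at_ends m l (\<theta> \<xi>)" "vanishes_at_ends m l (\<psi> \<xi>)"
      "\<forall>x\<in>{-m<..<0} \<union> {0<..<l}. mode_odes g \<rho>0 dP0 \<epsilon>0 \<delta>0 (\<Lambda> (norm \<xi>)) \<xi> (\<phi> \<xi>) (\<theta> \<xi>) (\<psi> \<xi>) x"
      using main unfolding normal_mode_def by blast+
    show "\<psi> \<xi> 0 \<noteq> 0" using S by (simp add: \<psi>_def)
  qed (use equivariant in blast)
qed

end
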